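(* Let $n\ge1$, let $\mathcal{H}\subset\mathbb{R}^{n+1}$ be a Euclidean complete connected hyperbolic centroaffine hypersurface, let $k>0$, let $h:U=\mathbb{R}^{>0}\cdot\mathcal{H}\to\mathbb{R}$ be the corresponding homogeneous function of degree $k$, and let $p\in\mathcal{H}$. Put $\bar h=h|_{U\cap E_p}$, where $E_p=p+T_p\mathcal{H}$ is the affine tangent hyperplane at $p$. Assume that there exists $\varepsilon\in(0,k)$ such that $f=\sqrt[k-\varepsilon]{\bar h}$ is concave. Then $\mathcal{H}$ is complete with respect to the centroaffine metric $g$.
   Context: Let $\tilde\nabla$ be the canonical flat connection on $\mathbb{R}^{n+1}$ and $\xi$ the position vector field. A smooth embedded hypersurface $\mathcal{H}\subset\mathbb{R}^{n+1}$ is centroaffine if $x\notin T_x\mathcal{H}$ for all $x\in\mathcal{H}$; its centroaffine metric $g$ is determined by $\tilde\nabla_XY=\nabla_XY+g(X,Y)\xi$ for $X,Y$ tangent to $\mathcal{H}$, with $\nabla_XY$ tangent to $\mathcal{H}$. It is hyperbolic if $g$ is positive definite, and Euclidean complete if it is complete for the Riemannian metric induced by the Euclidean scalar product. For such $\mathcal{H}$ the map $\mathbb{R}^{>0}\times\mathcal{H}\to U=\mathbb{R}^{>0}\cdot\mathcal{H}$, $(\lambda,x)\mapsto\lambda x$, is a diffeomorphism onto an open convex cone; the corresponding homogeneous function of degree $k$ is the smooth positive function $h$ on $U$ defined by $h(\lambda x)=\lambda^k$ for $\lambda>0$, $x\in\mathcal{H}$. *)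

theory Defs
  imports "HOL-Analysis.Analysis"
begin

section \<open>Smooth maps and embedded hypersurfaces\<close>

text \<open>The set \<open>S\<close> is meant to be open. In finite dimension, continuity of all iterated
  directional derivatives up to order \<open>k\<close> is continuity of the full \<open>k\<close>-th derivative.\<close>

fun Ck_on :: "nat \<Rightarrow> ('a::euclidean_space \<Rightarrow> 'b::euclidean_space) \<Rightarrow> 'a set \<Rightarrow> bool" where
  "Ck_on 0 f S \<longleftrightarrow> continuous_on S f"
| "Ck_on (Suc k) f S \<longleftrightarrow>
     f differentiable_on S \<and> (\<forall>v. Ck_on k (\<lambda>x. frechet_derivative f (at x) v) S)"

definition smooth_on :: "'a::euclidean_space set \<Rightarrow> ('a \<Rightarrow> 'b::euclidean_space) \<Rightarrow> bool" where
  "smooth_on S f \<longleftrightarrow> (\<forall>k. Ck_on k f S)"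

definition diffeomorphism :: "'a::euclidean_space set \<Rightarrow> 'b::euclidean_space set \<Rightarrow>
    ('a \<Rightarrow> 'b) \<Rightarrow> ('b \<Rightarrow> 'a) \<Rightarrow> bool" where
  "diffeomorphism S T f g \<longleftrightarrow>
     open S \<and> open T \<and> homeomorphism S T f g \<and> smooth_on S f \<and> smooth_on T g"

text \<open>Slice charts: locally the set is straightened to a coordinate hyperplane. As usual,
  an embedded submanifold is not required to be a closed subset.\<close>

definition embedded_hypersurface :: "'a::euclidean_space set \<Rightarrow> bool" where
  "embedded_hypersurface H \<longleftrightarrow>
     (\<forall>x\<in>H. \<exists>W V \<phi> \<psi> b. x \<in> W \<and> diffeomorphism W (V :: 'a set) \<phi> \<psi> \<and> b \<in> Basis \<and>
        \<phi> ` (H \<inter> W) = {z \<in> V. z \<bullet> b = 0})"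

definition tangent_space :: "'a::euclidean_space set \<Rightarrow> 'a \<Rightarrow> 'a set" where
  "tangent_space H x =
     {v. \<exists>\<gamma> e. e > 0 \<and> smooth_on {-e<..<e} \<gamma> \<and> \<gamma> ` {-e<..<e} \<subseteq> H \<and> \<gamma> 0 = x \<and>
         (\<gamma> has_vector_derivative v) (at (0::real))}"


section \<open>Centroaffine hypersurfaces\<close>

definition centroaffine_hypersurface :: "'a::euclidean_space set \<Rightarrow> bool" where
  "centroaffine_hypersurface H \<longleftrightarrow>
     embedded_hypersurface H \<and> (\<forall>x\<in>H. x \<notin> tangent_space H x)"

text \<open>A vector field on the ambient open set \<open>W\<close> whose restriction to \<open>H\<close> is tangent to \<open>H\<close>.
  Every smooth tangent field on \<open>H\<close> is locally such a restriction.\<close>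

definition tangent_field :: "'a::euclidean_space set \<Rightarrow> 'a set \<Rightarrow> ('a \<Rightarrow> 'a) \<Rightarrow> bool" where
  "tangent_field H W X \<longleftrightarrow> smooth_on W X \<and> (\<forall>y\<in>H \<inter> W. X y \<in> tangent_space H y)"

definition flat_connection ::
    "('a::euclidean_space \<Rightarrow> 'a) \<Rightarrow> ('a \<Rightarrow> 'a) \<Rightarrow> 'a \<Rightarrow> 'a" where
  "flat_connection X Y x = frechet_derivative Y (at x) (X x)"

text \<open>The value at the tangent vectors \<open>u\<close>, \<open>w\<close> at \<open>x\<close> is the coefficient \<open>c\<close> in the
  decomposition of the flat derivative of \<open>Y\<close> along \<open>X\<close> at \<open>x\<close> into a tangent part plus
  \<open>c\<close> times the position vector, for all local tangent fields \<open>X\<close>, \<open>Y\<close> through \<open>u\<close>, \<open>w\<close>.\<close>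

definition centroaffine_metric :: "'a::euclidean_space set \<Rightarrow> 'a \<Rightarrow> 'a \<Rightarrow> 'a \<Rightarrow> real" where
  "centroaffine_metric H x u w =
     (THE c. \<forall>W X Y. open W \<and> x \<in> W \<and> tangent_field H W X \<and> tangent_field H W Y \<and>
          X x = u \<and> Y x = w \<longrightarrow>
        flat_connection X Y x - c *\<^sub>R x \<in> tangent_space H x)"

definition hyperbolic_centroaffine :: "'a::euclidean_space set \<Rightarrow> bool" where
  "hyperbolic_centroaffine H \<longleftrightarrow>
     centroaffine_hypersurface H \<and>
     (\<forall>x\<in>H. \<forall>v\<in>tangent_space H x. v \<noteq> 0 \<longrightarrow> centroaffine_metric H x v v > 0)"


section \<open>Riemannian completeness\<close>

text \<open>\<open>G x u w\<close> is the metric at \<open>x\<close> on tangent vectors \<open>u\<close>, \<open>w\<close>. The predicate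
  \<^const>\<open>valid_path\<close> (piecewise \<open>C\<^sup>1\<close>) allows the velocity to blow up at finitely many
  parameters, so curves of infinite length are left out by demanding that the speed be
  integrable.\<close>

definition curve_lengths ::
    "'a::euclidean_space set \<Rightarrow> ('a \<Rightarrow> 'a \<Rightarrow> 'a \<Rightarrow> real) \<Rightarrow> 'a \<Rightarrow> 'a \<Rightarrow> real set" where
  "curve_lengths H G x y =
     {L. \<exists>\<gamma>. valid_path \<gamma> \<and> path_image \<gamma> \<subseteq> H \<and> pathstart \<gamma> = x \<and> pathfinish \<gamma> = y \<and>
         ((\<lambda>t. sqrt (G (\<gamma> t) (vector_derivative \<gamma> (at t)) (vector_derivative \<gamma> (at t))))
            has_integral L) {0..1}}"

text \<open>The first case is a convention for points that cannot be joined; it does not occur for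
  two points of a connected hypersurface.\<close>

definition riemannian_dist ::
    "'a::euclidean_space set \<Rightarrow> ('a \<Rightarrow> 'a \<Rightarrow> 'a \<Rightarrow> real) \<Rightarrow> 'a \<Rightarrow> 'a \<Rightarrow> real" where
  "riemannian_dist H G x y =
     (if curve_lengths H G x y = {} then 0 else Inf (curve_lengths H G x y))"

definition riemannian_complete ::
    "'a::euclidean_space set \<Rightarrow> ('a \<Rightarrow> 'a \<Rightarrow> 'a \<Rightarrow> real) \<Rightarrow> bool" where
  "riemannian_complete H G \<longleftrightarrow> Metric_space.mcomplete H (riemannian_dist H G)"

definition euclidean_complete :: "'a::euclidean_space set \<Rightarrow> bool" where
  "euclidean_complete H \<longleftrightarrow> riemannian_complete H (\<lambda>x u w. u \<bullet> w)"


section \<open>The cone over a hypersurface and its homogeneous functions\<close>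

definition positive_cone :: "'a::real_vector set \<Rightarrow> 'a set" where
  "positive_cone H = {r *\<^sub>R x | r x. r > 0 \<and> x \<in> H}"

definition corresponding_homogeneous ::
    "'a::real_vector set \<Rightarrow> real \<Rightarrow> ('a \<Rightarrow> real) \<Rightarrow> bool" where
  "corresponding_homogeneous H k h \<longleftrightarrow> (\<forall>r>0. \<forall>x\<in>H. h (r *\<^sub>R x) = r powr k)"

definition affine_tangent_hyperplane :: "'a::euclidean_space set \<Rightarrow> 'a \<Rightarrow> 'a set" where
  "affine_tangent_hyperplane H p = {p + v | v. v \<in> tangent_space H p}"

end

theory Submission
  imports Defs
begin

text \<open>The hypothesis on \<open>h\<close> gives a function \<open>F = h powr (1 / k)\<close> on the cone \<open>U\<close> that
  is homogeneous of degree one and has \<open>H = {F = 1}\<close>. It is differentiable, \<open>T\<^sub>x H\<close> is the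
  kernel of \<open>D F x\<close>, and the centroaffine metric measures the transversal part of acceleration:
  \<open>D F x (\<gamma>'') = g(\<gamma>', \<gamma>')\<close> for curves \<open>\<gamma>\<close> in \<open>H\<close> through \<open>x\<close>.

  Write \<open>l\<close> for the linear functional \<open>D F p\<close>, so that the affine tangent hyperplane is \<open>{l = 1}\<close>,
  write \<open>E\<close> for the section \<open>U \<inter> {l = 1}\<close>, and put \<open>\<beta> = k / (k - \<epsilon>) > 1\<close>. The concave function of
  the hypothesis is \<open>F powr \<beta>\<close> on \<open>E\<close>. It has a critical point at \<open>p\<close>, hence a maximum, and this
  says \<open>F \<le> l\<close> on \<open>U \<inter> {l > 0}\<close>. As \<open>H\<close> is connected, it lies in \<open>{l \<ge> 1}\<close>, and therefore \<open>U\<close>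
  is the cone over the convex set \<open>E\<close>.

  The heart of the matter is that \<open>\<beta> > 1\<close> gains a gradient term. The tangent plane of the graph of
  \<open>F powr \<beta>\<close> at \<open>x / l x\<close>, written homogeneously, bounds \<open>l z powr (1 - \<beta>)\<close> for \<open>z \<in> H\<close> by a linear
  functional of \<open>z\<close>, with equality at \<open>z = x\<close> (lemma \<open>supporting_bound\<close>). The second derivative of
  this inequality along a curve in \<open>H\<close> is
  \<open>g(v, v) \<ge> (\<beta> - 1) (l v / l x)\<^sup>2\<close> (lemma \<open>metric_lower_bound\<close>). So \<open>ln \<circ> l\<close> is Lipschitz for the
  centroaffine distance, and a Cauchy sequence stays in some \<open>{x \<in> H. l x \<le> R}\<close>.

  These sets are compact in the Euclidean topology (lemma \<open>compact_sublevel\<close>). They are bounded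
  because \<open>E\<close> is bounded: a positive continuous concave function with a strict maximum at an
  interior point cannot live on an unbounded convex set. They are closed because of Euclidean completeness: otherwise some boundary
  point \<open>y\<close> of \<open>E\<close> would be a limit of points of \<open>E\<close> at which \<open>F\<close> exceeds a positive constant, and the radial
  projection to \<open>H\<close> of the segment from \<open>p\<close> towards \<open>y\<close> would have finite Euclidean length without
  a limit in \<open>H\<close> (lemma \<open>limit_of_section_in_cone\<close>). A Cauchy sequence in a compact subset of \<open>H\<close>
  has a limit, since Euclidean convergence in \<open>H\<close> implies convergence in the distance.\<close>

section \<open>Calculus of smooth maps\<close>

abbreviation D :: "('a::euclidean_space \<Rightarrow> 'b::euclidean_space) \<Rightarrow> 'a \<Rightarrow> 'a \<Rightarrow> 'b" where
  "D f x \<equiv> frechet_derivative f (at x)"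

lemma Ck_on_has_derivative:
  assumes "Ck_on (Suc k) f S" "open S" "x \<in> S"
  shows "(f has_derivative D f x) (at x)"
proof -
  have "f differentiable at x"
    using assms by (auto simp: differentiable_on_eq_differentiable_at)
  then show ?thesis by (simp add: frechet_derivative_works)
qed

lemma smooth_on_has_derivative:
  assumes "smooth_on S f" "open S" "x \<in> S"
  shows "(f has_derivative D f x) (at x)"
  using assms Ck_on_has_derivative[of 0] unfolding smooth_on_def by blast

lemma smooth_on_derivative: "smooth_on S f \<Longrightarrow> smooth_on S (\<lambda>x. D f x v)"
  unfolding smooth_on_def using Ck_on.simps(2) by blast

lemma smooth_on_continuous: "smooth_on S f \<Longrightarrow> continuous_on S f"
  unfolding smooth_on_def using Ck_on.simps(1) by blast

lemma Ck_on_subset: "Ck_on k f S \<Longrightarrow> T \<subseteq> S \<Longrightarrow> Ck_on k f T"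
  by (induction k arbitrary: f) (auto intro: continuous_on_subset differentiable_on_subset)

lemma Ck_on_cong:
  assumes "open S" "Ck_on k f S" "\<And>x. x \<in> S \<Longrightarrow> f x = g x"
  shows "Ck_on k g S"
  using assms(2,3)
proof (induction k arbitrary: f g)
  case 0
  then show ?case using continuous_on_cong[of S S f g] by simp
next
  case (Suc k)
  have diff: "f differentiable at x" if "x \<in> S" for x
    using Suc.prems(1) assms(1) that by (auto simp: differentiable_on_eq_differentiable_at)
  have eq: "D f x = D g x" if "x \<in> S" for x
    using frechet_derivative_transform_within_open[OF diff[OF that] assms(1) that] Suc.prems(2)
    by blast
  have "(g has_derivative D f x) (at x)" if "x \<in> S" for x
    using has_derivative_transform_within_open[OF _ assms(1) that] Suc.prems(2)
      Ck_on_has_derivative[OF Suc.prems(1) assms(1) that] by blast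
  then have "g differentiable_on S"
    unfolding differentiable_on_eq_differentiable_at[OF assms(1)] differentiable_def by blast
  moreover have "Ck_on k (\<lambda>x. D g x v) S" for v
    using Suc.IH[of "\<lambda>x. D f x v" "\<lambda>x. D g x v"] Suc.prems(1) eq by simp
  ultimately show ?case by simp
qed

lemma Ck_on_bounded_linear:
  assumes "open S" "bounded_linear L" "Ck_on k f S"
  shows "Ck_on k (\<lambda>x. L (f x)) S"
  using assms(3)
proof (induction k arbitrary: f)
  case 0
  then show ?case
    using bounded_linear.continuous_on[OF assms(2)] by simp
next
  case (Suc k)
  have der: "((\<lambda>x. L (f x)) has_derivative (\<lambda>v. L (D f x v))) (at x)" if "x \<in> S" for x
    using bounded_linear.has_derivative[OF assms(2) Ck_on_has_derivative[OF Suc.prems assms(1) that]] .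
  have "(\<lambda>x. L (f x)) differentiable_on S"
    unfolding differentiable_on_eq_differentiable_at[OF assms(1)] differentiable_def
    using der by blast
  moreover have "Ck_on k (\<lambda>x. D (\<lambda>x. L (f x)) x v) S" for v
  proof (rule Ck_on_cong[OF assms(1)])
    show "Ck_on k (\<lambda>x. L (D f x v)) S" using Suc.IH Suc.prems by simp
    show "L (D f x v) = D (\<lambda>x. L (f x)) x v" if "x \<in> S" for x
      using fun_cong[OF frechet_derivative_at[OF der[OF that]]] .
  qed
  ultimately show ?case by simp
qed

lemma Ck_on_diff:
  assumes "open S" "Ck_on k f S" "Ck_on k g S"
  shows "Ck_on k (\<lambda>x. f x - g x) S"
  using assms(2,3)
proof (induction k arbitrary: f g)
  case 0
  then show ?case by (simp add: continuous_on_diff)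
next
  case (Suc k)
  have der: "((\<lambda>x. f x - g x) has_derivative (\<lambda>v. D f x v - D g x v)) (at x)" if "x \<in> S" for x
    by (intro has_derivative_diff Ck_on_has_derivative[OF Suc.prems(1) assms(1) that]
        Ck_on_has_derivative[OF Suc.prems(2) assms(1) that])
  have "(\<lambda>x. f x - g x) differentiable_on S"
    unfolding differentiable_on_eq_differentiable_at[OF assms(1)] differentiable_def
    using der by blast
  moreover have "Ck_on k (\<lambda>x. D (\<lambda>x. f x - g x) x v) S" for v
  proof (rule Ck_on_cong[OF assms(1)])
    show "Ck_on k (\<lambda>x. D f x v - D g x v) S" using Suc.IH Suc.prems by simp
    show "D f x v - D g x v = D (\<lambda>x. f x - g x) x v" if "x \<in> S" for x
      using fun_cong[OF frechet_derivative_at[OF der[OF that]]] .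
  qed
  ultimately show ?case by simp
qed

text \<open>Only affine substitutions into a smooth map are needed, and for these the induction on the order
  closes without a general chain rule: a directional derivative of \<open>\<lambda>t. f (a + t v)\<close> is
  a multiple of the same substitution into \<open>\<lambda>x. D f x v\<close>.\<close>

lemma Ck_on_line:
  fixes f :: "'a::euclidean_space \<Rightarrow> 'b::euclidean_space"
  assumes "open S" "Ck_on k f S"
  shows "Ck_on k (\<lambda>t::real. f (a + t *\<^sub>R v)) ((\<lambda>t. a + t *\<^sub>R v) -` S)"
  using assms(2)
proof (induction k arbitrary: f)
  case 0
  have "continuous_on ((\<lambda>t. a + t *\<^sub>R v) -` S) (\<lambda>t. f (a + t *\<^sub>R v))"
    by (rule continuous_on_compose2[of S f]) (use 0 in \<open>auto intro!: continuous_intros\<close>)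
  then show ?case by simp
next
  case (Suc k)
  let ?T = "(\<lambda>t. a + t *\<^sub>R v) -` S"
  have op: "open ?T"
    by (rule open_vimage[OF assms(1)]) (intro continuous_intros)
  have der: "((\<lambda>t. f (a + t *\<^sub>R v)) has_derivative (\<lambda>s. s *\<^sub>R D f (a + t *\<^sub>R v) v)) (at t)"
    if "t \<in> ?T" for t
  proof -
    have f: "(f has_derivative D f (a + t *\<^sub>R v)) (at (a + t *\<^sub>R v))"
      by (rule Ck_on_has_derivative[OF Suc.prems assms(1)]) (use that in auto)
    have "((\<lambda>t. a + t *\<^sub>R v) has_derivative (\<lambda>s. s *\<^sub>R v)) (at t)"
      by (auto intro!: derivative_eq_intros)
    from diff_chain_at[OF this f] show ?thesis
      by (simp add: o_def linear_cmul[OF has_derivative_linear[OF f]])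
  qed
  have "(\<lambda>t. f (a + t *\<^sub>R v)) differentiable_on ?T"
    unfolding differentiable_on_eq_differentiable_at[OF op] differentiable_def
    using der by blast
  moreover have "Ck_on k (\<lambda>t. D (\<lambda>t. f (a + t *\<^sub>R v)) t s) ?T" for s
  proof (rule Ck_on_cong[OF op])
    show "Ck_on k (\<lambda>t. s *\<^sub>R D f (a + t *\<^sub>R v) v) ?T"
      using Suc.prems by (intro Ck_on_bounded_linear[OF op bounded_linear_scaleR_right]
          Suc.IH[of "\<lambda>x. D f x v"]) simp
    show "s *\<^sub>R D f (a + t *\<^sub>R v) v = D (\<lambda>t. f (a + t *\<^sub>R v)) t s" if "t \<in> ?T" for t
      using fun_cong[OF frechet_derivative_at[OF der[OF that]]] .
  qed
  ultimately show ?case by simp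
qed

section \<open>Local defining functions and the centroaffine metric\<close>

text \<open>When \<open>H\<close> is centroaffine, the usual regularity \<open>D \<rho> y \<noteq> 0\<close>
  on \<open>H\<close> is a consequence, because \<open>y\<close> lies outside the tangent space and hence
  outside the kernel of \<open>D \<rho> y\<close>.\<close>

definition local_defining_function ::
    "'a::euclidean_space set \<Rightarrow> 'a set \<Rightarrow> ('a \<Rightarrow> real) \<Rightarrow> bool" where
  "local_defining_function H W \<rho> \<longleftrightarrow>
     open W \<and> smooth_on W \<rho> \<and> (\<forall>y\<in>W. y \<in> H \<longleftrightarrow> \<rho> y = 0) \<and>
     (\<forall>y\<in>H \<inter> W. tangent_space H y = {v. D \<rho> y v = 0})"

lemma has_vector_derivative_eventually_eq:
  assumes "(f has_vector_derivative d) (at t)" "eventually (\<lambda>s. f s = g s) (nhds t)"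
  shows "(g has_vector_derivative d) (at t)"
  using has_vector_derivative_cong_ev[where S = UNIV and x = t and f = f and g = g and f' = d]
    assms eventually_nhds_x_imp_x[OF assms(2)]
  by simp

lemma derivative_along_curve_in_zero_set:
  fixes f :: "'a::euclidean_space \<Rightarrow> 'b::euclidean_space"
  assumes "(f has_derivative f') (at (\<gamma> t))" "(\<gamma> has_vector_derivative v) (at t)"
    and "eventually (\<lambda>s. f (\<gamma> s) = c) (nhds t)"
  shows "f' v = 0"
proof -
  have "((\<lambda>s. f (\<gamma> s)) has_vector_derivative f' v) (at t)"
    using vector_derivative_diff_chain_within[OF assms(2) has_derivative_at_withinI[OF assms(1)]]
    by (simp add: o_def)
  moreover have "((\<lambda>s. f (\<gamma> s)) has_vector_derivative 0) (at t)"
    by (rule has_vector_derivative_eventually_eq[OF has_vector_derivative_const],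
        rule eventually_mono[OF assms(3)]) simp
  ultimately show ?thesis by (metis vector_derivative_at)
qed

lemma curve_eventually_in_open:
  assumes "open W" "\<gamma> t \<in> W" "(\<gamma> has_vector_derivative v) (at (t::real))"
  shows "eventually (\<lambda>s. \<gamma> s \<in> W) (nhds t)"
proof -
  have "isCont \<gamma> t" using assms(3) has_vector_derivative_continuous by blast
  then have "filterlim \<gamma> (nhds (\<gamma> t)) (nhds t)"
    by (simp add: continuous_at_imp_continuous_at_within isCont_def tendsto_at_iff_tendsto_nhds)
  then show ?thesis using assms topological_tendstoD by blast
qed

lemma tangent_spaceE:
  assumes "v \<in> tangent_space H x"
  obtains \<gamma> e where "e > 0" "\<And>t. -e < t \<Longrightarrow> t < e \<Longrightarrow> \<gamma> t \<in> H" "\<gamma> 0 = x"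
    "(\<gamma> has_vector_derivative v) (at (0::real))" "smooth_on {-e<..<e} \<gamma>"
proof -
  obtain \<gamma> e where 1: "e > 0" "smooth_on {-e<..<e} \<gamma>" "\<gamma> ` {-e<..<e} \<subseteq> H" "\<gamma> 0 = x"
    "(\<gamma> has_vector_derivative v) (at (0::real))"
    using assms unfolding tangent_space_def by blast
  then show thesis using that[of e \<gamma>] by (auto simp: image_subset_iff)
qed

text \<open>The coordinate of a slice chart that vanishes on \<open>H\<close> is a defining function. A
  vector in the kernel of its differential is tangent to \<open>H\<close> because the chart carries it to a
  direction in the slice, and a straight line in the slice pulls back to a smooth curve in
  \<open>H\<close>.\<close>

lemma embedded_hypersurface_defining_function:
  assumes "embedded_hypersurface H" "x \<in> H"
  obtains W \<rho> where "x \<in> W" "local_defining_function H W \<rho>"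
proof -
  obtain W V \<phi> \<psi> b where x: "x \<in> W" and diffeo: "diffeomorphism W (V :: 'a set) \<phi> \<psi>" and b: "b \<in> Basis"
    and im: "\<phi> ` (H \<inter> W) = {z \<in> V. z \<bullet> b = 0}"
    using assms unfolding embedded_hypersurface_def by meson
  have op: "open W" "open V" and sm: "smooth_on W \<phi>" "smooth_on V \<psi>"
    and hom: "homeomorphism W V \<phi> \<psi>"
    using diffeo unfolding diffeomorphism_def by auto
  have inv: "\<psi> (\<phi> y) = y" "\<phi> y \<in> V" if "y \<in> W" for y
    using hom that unfolding homeomorphism_def by auto
  have inv': "\<phi> (\<psi> z) = z" "\<psi> z \<in> W" if "z \<in> V" for z
    using hom that unfolding homeomorphism_def by auto
  define \<rho> where "\<rho> = (\<lambda>y. \<phi> y \<bullet> b)"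
  have sm\<rho>: "smooth_on W \<rho>"
    using sm(1) Ck_on_bounded_linear[OF op(1) bounded_linear_inner_left]
    unfolding smooth_on_def \<rho>_def by blast
  have \<phi>': "(\<phi> has_derivative D \<phi> y) (at y)" if "y \<in> W" for y
    using smooth_on_has_derivative[OF sm(1) op(1) that] .
  have \<rho>': "(\<rho> has_derivative (\<lambda>v. D \<phi> y v \<bullet> b)) (at y)" if "y \<in> W" for y
    unfolding \<rho>_def using bounded_linear.has_derivative[OF bounded_linear_inner_left \<phi>'[OF that]] .
  have D\<rho>: "D \<rho> y v = D \<phi> y v \<bullet> b" if "y \<in> W" for y v
    using frechet_derivative_at[OF \<rho>'[OF that]] by metis
  have iff: "y \<in> H \<longleftrightarrow> \<rho> y = 0" if "y \<in> W" for y
  proof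
    show "\<rho> y = 0" if "y \<in> H" using im that \<open>y \<in> W\<close> unfolding \<rho>_def by blast
    assume "\<rho> y = 0"
    then have "\<phi> y \<in> \<phi> ` (H \<inter> W)" using im inv(2) that unfolding \<rho>_def by blast
    then show "y \<in> H" using inv(1) that by (metis IntD1 IntD2 imageE)
  qed
  have "tangent_space H y = {v. D \<rho> y v = 0}" if "y \<in> H" "y \<in> W" for y
  proof (intro equalityI subsetI CollectI)
    fix v assume "v \<in> tangent_space H y"
    then obtain \<gamma> e where \<gamma>: "e > 0" "\<And>t. -e < t \<Longrightarrow> t < e \<Longrightarrow> \<gamma> t \<in> H" "\<gamma> 0 = y"
      "(\<gamma> has_vector_derivative v) (at (0::real))" "smooth_on {-e<..<e} \<gamma>"
      using tangent_spaceE by blast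
    have "eventually (\<lambda>t. \<gamma> t \<in> W) (nhds 0)"
      using curve_eventually_in_open[OF op(1) _ \<gamma>(4)] \<gamma>(3) that by simp
    moreover have "eventually (\<lambda>t. t \<in> {-e<..<e}) (nhds 0)"
      using \<gamma>(1) by (intro eventually_nhds_in_open) auto
    ultimately have "eventually (\<lambda>t. \<rho> (\<gamma> t) = 0) (nhds 0)"
      by eventually_elim (use iff \<gamma>(2) in auto)
    then show "D \<rho> y v = 0"
      using derivative_along_curve_in_zero_set[where t = 0] \<rho>'[OF that(2)] D\<rho>[OF that(2)] \<gamma>(3,4)
      by metis
  next
    fix v assume "v \<in> {v. D \<rho> y v = 0}"
    then have v: "D \<phi> y v \<bullet> b = 0" using D\<rho> that by simp
    define w where "w = D \<phi> y v"
    let ?T = "(\<lambda>t. \<phi> y + t *\<^sub>R w) -` V"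
    have "open ?T"
      by (rule open_vimage[OF op(2)]) (intro continuous_intros)
    moreover have "0 \<in> ?T" using inv(2) that by simp
    ultimately obtain e where e: "e > 0" "ball 0 e \<subseteq> ?T"
      by (meson openE)
    have sub: "{-e<..<e} \<subseteq> ?T" using e(2) by (auto simp: subset_iff dist_real_def abs_less_iff)
    define \<gamma> where "\<gamma> = (\<lambda>t. \<psi> (\<phi> y + t *\<^sub>R w))"
    have "smooth_on {-e<..<e} \<gamma>"
      unfolding smooth_on_def \<gamma>_def
      using Ck_on_subset[OF Ck_on_line[OF op(2)] sub] sm(2) unfolding smooth_on_def by blast
    moreover have "\<gamma> ` {-e<..<e} \<subseteq> H"
    proof
      fix z assume "z \<in> \<gamma> ` {-e<..<e}"
      then obtain t where t: "\<phi> y + t *\<^sub>R w \<in> V" "z = \<psi> (\<phi> y + t *\<^sub>R w)"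
        using sub unfolding \<gamma>_def by auto
      then have "\<rho> z = 0" 
        using inv'(1) iff[OF that(2)] that(1) v unfolding \<rho>_def w_def by (simp add: inner_add_left)
      then show "z \<in> H" using iff inv'(2) t by metis
    qed
    moreover have "\<gamma> 0 = y" using inv(1) that unfolding \<gamma>_def by simp
    moreover have "(\<gamma> has_vector_derivative v) (at 0)"
    proof -
      have \<psi>: "(\<psi> has_derivative D \<psi> (\<phi> y)) (at (\<phi> y))"
        using smooth_on_has_derivative[OF sm(2) op(2) inv(2)[OF that(2)]] .
      have "((\<lambda>z. \<psi> (\<phi> z)) has_derivative (\<lambda>v. D \<psi> (\<phi> y) (D \<phi> y v))) (at y)"
        using diff_chain_at[OF \<phi>'[OF that(2)] \<psi>] by (simp add: o_def)
      moreover have "((\<lambda>z. \<psi> (\<phi> z)) has_derivative (\<lambda>v. v)) (at y)"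
        by (rule has_derivative_transform_within_open[OF has_derivative_ident op(1) that(2)])
          (simp add: inv(1))
      ultimately have eq: "D \<psi> (\<phi> y) w = v"
        unfolding w_def using has_derivative_unique by metis
      have "((\<lambda>t. \<phi> y + t *\<^sub>R w) has_vector_derivative w) (at 0)"
        by (auto intro!: derivative_eq_intros)
      from vector_derivative_diff_chain_within[OF this, of \<psi> "D \<psi> (\<phi> y)"] \<psi>
      show ?thesis unfolding \<gamma>_def eq[symmetric]
        by (simp add: o_def has_derivative_at_withinI)
    qed
    ultimately show "v \<in> tangent_space H y"
      unfolding tangent_space_def using e(1) by blast
  qed
  then have "local_defining_function H W \<rho>"
    unfolding local_defining_function_def using op sm\<rho> iff by auto
  then show thesis using that x by blast
qed

text \<open>The second derivative of \<open>\<rho>\<close> in the directions \<open>u\<close> and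
  \<open>w\<close>; expanding only \<open>w\<close> in coordinates keeps the definition within first
  derivatives of the functions \<open>\<lambda>z. D \<rho> z i\<close>.\<close>

definition D2 :: "('a::euclidean_space \<Rightarrow> real) \<Rightarrow> 'a \<Rightarrow> 'a \<Rightarrow> 'a \<Rightarrow> real" where
  "D2 \<rho> x u w = (\<Sum>i\<in>Basis. (w \<bullet> i) * D (\<lambda>z. D \<rho> z i) x u)"

lemma linear_functional_components:
  fixes f :: "'a::euclidean_space \<Rightarrow> real"
  assumes "linear f"
  shows "f w = (\<Sum>i\<in>Basis. (w \<bullet> i) * f i)"
proof -
  have "f w = f (\<Sum>i\<in>Basis. (w \<bullet> i) *\<^sub>R i)" by (simp add: euclidean_representation)
  also have "\<dots> = (\<Sum>i\<in>Basis. (w \<bullet> i) * f i)"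
    by (simp add: linear_sum[OF assms] linear_cmul[OF assms])
  finally show ?thesis .
qed

lemma derivative_of_differential_along_curve:
  fixes \<rho> :: "'a::euclidean_space \<Rightarrow> real"
  assumes "open W" "smooth_on W \<rho>" "\<gamma> t \<in> W"
    and "(\<gamma> has_vector_derivative u) (at t)" "(Z has_vector_derivative \<zeta>) (at t)"
  shows "((\<lambda>s. D \<rho> (\<gamma> s) (Z s)) has_vector_derivative D \<rho> (\<gamma> t) \<zeta> + D2 \<rho> (\<gamma> t) u (Z t)) (at t)"
proof -
  have lin: "linear (D \<rho> y)" if "y \<in> W" for y
    using has_derivative_linear[OF smooth_on_has_derivative[OF assms(2,1) that]] .
  have d1: "((\<lambda>s. D \<rho> (\<gamma> s) i) has_vector_derivative D (\<lambda>z. D \<rho> z i) (\<gamma> t) u) (at t)" for i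
  proof -
    have "((\<lambda>z. D \<rho> z i) has_derivative D (\<lambda>z. D \<rho> z i) (\<gamma> t)) (at (\<gamma> t))"
      by (rule smooth_on_has_derivative[OF smooth_on_derivative[OF assms(2)] assms(1,3)])
    from vector_derivative_diff_chain_within[OF assms(4) has_derivative_at_withinI[OF this]]
    show ?thesis by (simp add: o_def)
  qed
  have d2: "((\<lambda>s. Z s \<bullet> i) has_vector_derivative \<zeta> \<bullet> i) (at t)" for i
    using bounded_linear.has_vector_derivative[OF bounded_linear_inner_left assms(5)] .
  have "((\<lambda>s. \<Sum>i\<in>Basis. (Z s \<bullet> i) * D \<rho> (\<gamma> s) i) has_vector_derivative
     (\<Sum>i\<in>Basis. (Z t \<bullet> i) * D (\<lambda>z. D \<rho> z i) (\<gamma> t) u + (\<zeta> \<bullet> i) * D \<rho> (\<gamma> t) i)) (at t)"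
    by (intro has_vector_derivative_sum has_vector_derivative_mult d1 d2)
  also have "(\<Sum>i\<in>Basis. (Z t \<bullet> i) * D (\<lambda>z. D \<rho> z i) (\<gamma> t) u + (\<zeta> \<bullet> i) * D \<rho> (\<gamma> t) i)
      = D \<rho> (\<gamma> t) \<zeta> + D2 \<rho> (\<gamma> t) u (Z t)"
    using linear_functional_components[OF lin[OF assms(3)], of \<zeta>]
    by (simp add: D2_def sum.distrib)
  finally have *: "((\<lambda>s. \<Sum>i\<in>Basis. (Z s \<bullet> i) * D \<rho> (\<gamma> s) i) has_vector_derivative
      D \<rho> (\<gamma> t) \<zeta> + D2 \<rho> (\<gamma> t) u (Z t)) (at t)" .
  have ev: "eventually (\<lambda>s. (\<Sum>i\<in>Basis. (Z s \<bullet> i) * D \<rho> (\<gamma> s) i) = D \<rho> (\<gamma> s) (Z s)) (nhds t)"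
    using curve_eventually_in_open[OF assms(1,3,4)]
    by eventually_elim (metis linear_functional_components lin)
  show ?thesis
    by (rule has_vector_derivative_eventually_eq[OF * ev])
qed

text \<open>The equation \<open>D \<rho> (\<gamma> s) (Z s) = 0\<close> expresses that \<open>Z\<close> is
  tangent; this is its derivative. It is applied both to tangent fields restricted to a curve, which
  identifies the metric, and to \<open>Z = \<gamma>'\<close>, which reads the metric off
  accelerations.\<close>

lemma differential_of_tangent_field_derivative:
  assumes "local_defining_function H W \<rho>" "\<gamma> t \<in> W"
    and "(\<gamma> has_vector_derivative u) (at t)" "(Z has_vector_derivative \<zeta>) (at t)"
    and "eventually (\<lambda>s. \<gamma> s \<in> H \<and> Z s \<in> tangent_space H (\<gamma> s)) (nhds t)"
  shows "D \<rho> (\<gamma> t) \<zeta> = - D2 \<rho> (\<gamma> t) u (Z t)"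
proof -
  have op: "open W" "smooth_on W \<rho>" and T: "\<And>y. y \<in> H \<Longrightarrow> y \<in> W \<Longrightarrow> tangent_space H y = {v. D \<rho> y v = 0}"
    using assms(1) unfolding local_defining_function_def by auto
  have ev: "eventually (\<lambda>s. D \<rho> (\<gamma> s) (Z s) = 0) (nhds t)"
    using curve_eventually_in_open[OF op(1) assms(2,3)] assms(5)
    by eventually_elim (use T in auto)
  have "((\<lambda>s. D \<rho> (\<gamma> s) (Z s)) has_vector_derivative 0) (at t)"
    by (rule has_vector_derivative_eventually_eq[OF has_vector_derivative_const],
        rule eventually_mono[OF ev]) simp
  with derivative_of_differential_along_curve[OF op assms(2-4)] show ?thesis
    by (metis add_eq_0_iff2 vector_derivative_at)
qed

text \<open>Applying \<open>D \<rho> x\<close> to the decomposition of a flat derivative kills its tangent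
  part and leaves an equation for the coefficient of \<open>x\<close>. The description of the metric
  determines this coefficient only if tangent fields with prescribed values at \<open>x\<close> exist; the
  field \<open>X\<close> below, which interchanges \<open>v\<close> with a fixed transversal vector
  \<open>a\<close>, lies in the kernel of \<open>D \<rho> z\<close> at every \<open>z\<close> for purely
  algebraic reasons.\<close>

lemma centroaffine_metric_eq:
  assumes "centroaffine_hypersurface H" "local_defining_function H W \<rho>" "x \<in> H" "x \<in> W"
    and u: "u \<in> tangent_space H x" and w: "w \<in> tangent_space H x"
  shows "centroaffine_metric H x u w = - D2 \<rho> x u w / D \<rho> x x"
proof -
  have op: "open W" "smooth_on W \<rho>" and T: "\<And>y. y \<in> H \<Longrightarrow> y \<in> W \<Longrightarrow> tangent_space H y = {v. D \<rho> y v = 0}"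
    using assms(2) unfolding local_defining_function_def by auto
  have lin: "linear (D \<rho> y)" if "y \<in> W" for y
    using has_derivative_linear[OF smooth_on_has_derivative[OF op(2,1) that]] .
  have nz: "D \<rho> x x \<noteq> 0"
    using assms T unfolding centroaffine_hypersurface_def by auto
  let ?c = "- D2 \<rho> x u w / D \<rho> x x"
  have key: "flat_connection X Y x - c *\<^sub>R x \<in> tangent_space H x \<longleftrightarrow> c = ?c"
    if "open W'" "x \<in> W'" "tangent_field H W' X" "tangent_field H W' Y" "X x = u" "Y x = w" for W' X Y c
  proof -
    obtain \<gamma> e where \<gamma>: "e > 0" "\<And>t. -e < t \<Longrightarrow> t < e \<Longrightarrow> \<gamma> t \<in> H" "\<gamma> 0 = x"
      "(\<gamma> has_vector_derivative u) (at (0::real))" "smooth_on {-e<..<e} \<gamma>"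
      using tangent_spaceE[OF u] by blast
    have Y: "(Y has_derivative D Y x) (at x)"
      using that smooth_on_has_derivative unfolding tangent_field_def by blast
    have Z: "((\<lambda>t. Y (\<gamma> t)) has_vector_derivative D Y x u) (at 0)"
      using vector_derivative_diff_chain_within[OF \<gamma>(4), of Y "D Y x"] Y \<gamma>(3)
      by (simp add: o_def has_derivative_at_withinI)
    have "eventually (\<lambda>t. \<gamma> t \<in> W') (nhds 0)"
      using curve_eventually_in_open[OF that(1) _ \<gamma>(4)] \<gamma>(3) that by simp
    moreover have "eventually (\<lambda>t. t \<in> {-e<..<e}) (nhds 0)"
      using \<gamma>(1) by (intro eventually_nhds_in_open) auto
    ultimately have "eventually (\<lambda>t. \<gamma> t \<in> H \<and> Y (\<gamma> t) \<in> tangent_space H (\<gamma> t)) (nhds 0)"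
      by eventually_elim (use \<gamma>(2) that(4) in \<open>auto simp: tangent_field_def\<close>)
    then have "D \<rho> x (D Y x u) = - D2 \<rho> x u w"
      using differential_of_tangent_field_derivative[OF assms(2) _ \<gamma>(4) Z] \<gamma>(3) that assms by simp
    moreover have "D \<rho> x (D Y x u - c *\<^sub>R x) = D \<rho> x (D Y x u) - c * D \<rho> x x"
      using lin[OF assms(4)] by (simp add: linear_diff linear_cmul)
    moreover have "flat_connection X Y x = D Y x u"
      by (simp add: flat_connection_def that(5))
    ultimately have "flat_connection X Y x - c *\<^sub>R x \<in> tangent_space H x \<longleftrightarrow>
        - D2 \<rho> x u w - c * D \<rho> x x = 0"
      using T[OF assms(3,4)] by simp
    also have "\<dots> \<longleftrightarrow> c = ?c" using nz by (auto simp: field_simps)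
    finally show ?thesis .
  qed
  have ex: "\<exists>X. tangent_field H W X \<and> X x = v" if "v \<in> tangent_space H x" for v
  proof -
    \<comment> \<open>A transversal vector with \<open>D \<rho> x a = 1\<close>, so that the field below
      takes the value \<open>v\<close> at \<open>x\<close>.\<close>
    define a where "a = (1 / D \<rho> x x) *\<^sub>R x"
    define X where "X = (\<lambda>z. D \<rho> z a *\<^sub>R v - D \<rho> z v *\<^sub>R a)"
    have "smooth_on W X"
      unfolding X_def smooth_on_def
      using smooth_on_derivative[OF op(2)] unfolding smooth_on_def
      by (intro allI Ck_on_diff[OF op(1)] Ck_on_bounded_linear[OF op(1) bounded_linear_scaleR_left]) auto
    moreover have "X y \<in> tangent_space H y" if "y \<in> H" "y \<in> W" for y
      using T[OF that] lin[OF that(2)] unfolding X_def by (simp add: linear_diff linear_cmul)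
    moreover have "D \<rho> x a = 1" unfolding a_def using lin[OF assms(4)] nz by (simp add: linear_cmul)
    then have "X x = v" unfolding X_def using that T assms by simp
    ultimately show ?thesis unfolding tangent_field_def by blast
  qed
  show ?thesis
    unfolding centroaffine_metric_def
  proof (rule the_equality)
    show "\<forall>W X Y. open W \<and> x \<in> W \<and> tangent_field H W X \<and> tangent_field H W Y \<and>
          X x = u \<and> Y x = w \<longrightarrow> flat_connection X Y x - ?c *\<^sub>R x \<in> tangent_space H x"
      using key by blast
    show "c = ?c" if "\<forall>W X Y. open W \<and> x \<in> W \<and> tangent_field H W X \<and> tangent_field H W Y \<and>
          X x = u \<and> Y x = w \<longrightarrow> flat_connection X Y x - c *\<^sub>R x \<in> tangent_space H x" for c
    proof -
      obtain X Y where "tangent_field H W X" "X x = u" "tangent_field H W Y" "Y x = w"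
        using ex[OF u] ex[OF w] by blast
      then show ?thesis using key[OF op(1) assms(4), of X Y c] that op(1) assms(4) by blast
    qed
  qed
qed

section \<open>The radial function of a hypersurface\<close>

lemma tendsto_linear_functional_field:
  fixes A :: "'a::euclidean_space \<Rightarrow> 'a \<Rightarrow> real"
  assumes "open W" "z \<in> W" "\<And>y. y \<in> W \<Longrightarrow> linear (A y)" "\<And>v. continuous_on W (\<lambda>y. A y v)"
    and "(a \<longlongrightarrow> z) L" "(b \<longlongrightarrow> w) L"
  shows "((\<lambda>s. A (a s) (b s)) \<longlongrightarrow> A z w) L"
proof -
  have c: "((\<lambda>s. A (a s) i) \<longlongrightarrow> A z i) L" for i
    using assms(1,2,4) continuous_on_eq_continuous_at isCont_tendsto_compose[OF _ assms(5)] by blast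
  have "((\<lambda>s. \<Sum>i\<in>Basis. (b s \<bullet> i) * A (a s) i) \<longlongrightarrow> (\<Sum>i\<in>Basis. (w \<bullet> i) * A z i)) L"
    by (intro tendsto_sum tendsto_mult tendsto_inner tendsto_const c assms(6))
  moreover have "eventually (\<lambda>s. (\<Sum>i\<in>Basis. (b s \<bullet> i) * A (a s) i) = A (a s) (b s)) L"
    using topological_tendstoD[OF assms(5,1,2)]
    by eventually_elim (metis linear_functional_components assms(3))
  ultimately show ?thesis
    unfolding linear_functional_components[OF assms(3)[OF assms(2)], of w]
    by (rule Lim_transform_eventually)
qed

lemma tendsto_differential:
  fixes f :: "'a::euclidean_space \<Rightarrow> real"
  assumes "open W" "smooth_on W f" "z \<in> W" "(a \<longlongrightarrow> z) L" "(b \<longlongrightarrow> w) L"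
  shows "((\<lambda>s. D f (a s) (b s)) \<longlongrightarrow> D f z w) L"
  by (rule tendsto_linear_functional_field[OF assms(1,3) _ _ assms(4,5)])
    (use has_derivative_linear[OF smooth_on_has_derivative[OF assms(2,1)]]
       smooth_on_continuous[OF smooth_on_derivative[OF assms(2)]] in auto)

text \<open>The second assumption forces \<open>H\<close> to meet each ray at most once. That the cone is
  open and \<open>F\<close> is differentiable on it follows from the hypersurface being embedded and
  transversal to the rays.\<close>

locale radial_hypersurface =
  fixes H :: "'a::euclidean_space set" and F :: "'a \<Rightarrow> real"
  assumes centroaffine: "centroaffine_hypersurface H"
    and F_ray: "r > 0 \<Longrightarrow> x \<in> H \<Longrightarrow> F (r *\<^sub>R x) = r"
begin

abbreviation U :: "'a set" where "U \<equiv> positive_cone H"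

definition proj :: "'a \<Rightarrow> 'a" where "proj z = (1 / F z) *\<^sub>R z"

lemma F_eq_1: "x \<in> H \<Longrightarrow> F x = 1"
  using F_ray[of 1 x] by simp

lemma in_U_cases:
  assumes "z \<in> U"
  obtains x where "x \<in> H" "z = F z *\<^sub>R x" "F z > 0"
proof -
  obtain r x where "r > 0" "x \<in> H" "z = r *\<^sub>R x"
    using assms unfolding positive_cone_def by blast
  then show thesis using that[of x] by (simp add: F_ray)
qed

lemma scaleR_in_U: "r > 0 \<Longrightarrow> x \<in> H \<Longrightarrow> r *\<^sub>R x \<in> U"
  unfolding positive_cone_def by blast

lemma H_subset_U: "x \<in> H \<Longrightarrow> x \<in> U"
  using scaleR_in_U[of 1 x] by simp

lemma F_pos: "z \<in> U \<Longrightarrow> F z > 0"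
  by (meson in_U_cases)

lemma proj_in_H: "z \<in> U \<Longrightarrow> proj z \<in> H"
proof -
  assume "z \<in> U"
  then obtain x where x: "x \<in> H" "z = F z *\<^sub>R x" "F z > 0" by (rule in_U_cases)
  have "proj z = (1 / F z) *\<^sub>R F z *\<^sub>R x" unfolding proj_def by (subst x(2)[symmetric]) simp
  also have "\<dots> = x" using x(3) by simp
  finally show ?thesis using x(1) by simp
qed

lemma proj_fixes_H: "x \<in> H \<Longrightarrow> proj x = x"
  by (simp add: proj_def F_eq_1)

lemma F_eq_1_iff: "z \<in> U \<Longrightarrow> F z = 1 \<longleftrightarrow> z \<in> H"
  using F_eq_1 proj_in_H[of z] by (auto simp: proj_def)

lemma U_scale: assumes "z \<in> U" "r > 0" shows "r *\<^sub>R z \<in> U" "F (r *\<^sub>R z) = r * F z"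
proof -
  obtain x where x: "x \<in> H" "z = F z *\<^sub>R x" "F z > 0" using assms(1) by (rule in_U_cases)
  have eq: "r *\<^sub>R z = (r * F z) *\<^sub>R x" by (subst x(2)) simp
  show "r *\<^sub>R z \<in> U" unfolding eq by (rule scaleR_in_U) (use assms x in auto)
  show "F (r *\<^sub>R z) = r * F z" unfolding eq by (rule F_ray) (use assms x in auto)
qed

lemma defining_function_at:
  assumes "x \<in> H"
  obtains W \<rho> where "x \<in> W" "local_defining_function H W \<rho>"
  using embedded_hypersurface_defining_function assms centroaffine
  unfolding centroaffine_hypersurface_def by blast

lemma defining_function_radial_derivative:
  assumes "local_defining_function H W \<rho>" "x \<in> H" "x \<in> W"
  shows "D \<rho> x x \<noteq> 0"
  using assms centroaffine unfolding centroaffine_hypersurface_def local_defining_function_def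
  by auto

text \<open>A defining function changes sign along the ray through \<open>x\<close> when it crosses
  \<open>H\<close>. By continuity it changes sign between the same two radii along all nearby rays, so by
  the intermediate value theorem these rays meet \<open>H\<close> near \<open>x\<close>. This gives at once
  the openness of the cone and the continuity of \<open>F\<close>.\<close>

lemma F_near_hypersurface:
  assumes "x \<in> H" "\<eta> > 0"
  shows "eventually (\<lambda>y. y \<in> U \<and> \<bar>F y - 1\<bar> < \<eta>) (nhds x)"
proof -
  obtain W \<rho> where W: "x \<in> W" and ldf: "local_defining_function H W \<rho>"
    using defining_function_at[OF assms(1)] by blast
  have op: "open W" and sm: "smooth_on W \<rho>" and zero: "\<And>y. y \<in> W \<Longrightarrow> y \<in> H \<longleftrightarrow> \<rho> y = 0"
    using ldf unfolding local_defining_function_def by auto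
  define c where "c = D \<rho> x x"
  have c: "c \<noteq> 0" using defining_function_radial_derivative[OF ldf assms(1) W] by (simp add: c_def)
  have \<rho>': "(\<rho> has_derivative D \<rho> x) (at x)"
    by (rule smooth_on_has_derivative[OF sm op W])
  have cont: "continuous_on W \<rho>" by (rule smooth_on_continuous[OF sm])
  define q where "q = (\<lambda>r. \<rho> (r *\<^sub>R x) / c)"
  have q': "(q has_real_derivative 1) (at 1)"
  proof -
    have "((\<lambda>r. r *\<^sub>R x) has_vector_derivative x) (at 1)"
      by (auto intro!: derivative_eq_intros)
    then have "((\<lambda>r. \<rho> (r *\<^sub>R x)) has_vector_derivative c) (at 1)"
      using vector_derivative_diff_chain_within[of "\<lambda>r. r *\<^sub>R x" x 1 UNIV \<rho> "D \<rho> x"] \<rho>'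
      by (simp add: o_def has_derivative_at_withinI c_def)
    then have "((\<lambda>r. \<rho> (r *\<^sub>R x)) has_real_derivative c) (at 1)"
      by (simp add: has_real_derivative_iff_has_vector_derivative)
    from DERIV_cdivide[OF this, of c] show ?thesis using c by (simp add: q_def)
  qed
  have q1: "q 1 = 0" using zero[OF W] assms(1) by (simp add: q_def)
  obtain d1 where d1: "d1 > 0" "\<And>h. 0 < h \<Longrightarrow> h < d1 \<Longrightarrow> q (1 + h) > 0"
    using DERIV_pos_inc_right[OF q'] q1 by auto
  obtain d2 where d2: "d2 > 0" "\<And>h. 0 < h \<Longrightarrow> h < d2 \<Longrightarrow> q (1 - h) < 0"
    using DERIV_pos_inc_left[OF q'] q1 by auto
  have "open ((\<lambda>p :: real \<times> 'a. fst p *\<^sub>R snd p) -` W)"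
    by (rule open_vimage[OF op]) (intro continuous_intros)
  moreover have "(1, x) \<in> (\<lambda>p :: real \<times> 'a. fst p *\<^sub>R snd p) -` W" using W by simp
  ultimately obtain A B where "open A" "open B" "(1, x) \<in> A \<times> B"
    and AB5: "A \<times> B \<subseteq> (\<lambda>p :: real \<times> 'a. fst p *\<^sub>R snd p) -` W"
    by (rule open_prod_elim)
  then have AB: "open A" "open B" "1 \<in> A" "x \<in> B" by auto
  obtain d3 where d3: "d3 > 0" "ball 1 d3 \<subseteq> A" using AB(1,3) openE by blast
  \<comment> \<open>The bound \<open>2 * h < \<eta>\<close> will control \<open>1 / r - 1\<close> for
    \<open>\<bar>r - 1\<bar> \<le> h \<le> 1/2\<close>.\<close>
  define h where "h = min (min d1 d2) (min (min d3 \<eta>) 1) / 3"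
  have h: "h > 0" "h < d1" "h < d2" "h < d3" "h \<le> 1/2" "2 * h < \<eta>"
    using d1 d2 d3 assms(2) by (auto simp: h_def min_def)
  have inW: "r *\<^sub>R y \<in> W" if "\<bar>r - 1\<bar> \<le> h" "y \<in> B" for r y
  proof -
    have "r \<in> A" using d3(2) that h by (auto simp: subset_iff dist_real_def)
    then show ?thesis using AB5 that by auto
  qed
  have ev: "eventually (\<lambda>y. \<rho> (r *\<^sub>R y) / c \<in> S) (nhds x)"
    if "\<bar>r - 1\<bar> \<le> h" "q r \<in> S" "open S" for r S
  proof -
    have "continuous_on B (\<lambda>y. \<rho> (r *\<^sub>R y) / c)"
      by (intro continuous_on_divide continuous_on_const c continuous_on_compose2[OF cont]
          continuous_intros) (use inW that c in auto)
    then have "isCont (\<lambda>y. \<rho> (r *\<^sub>R y) / c) x"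
      using AB by (simp add: continuous_on_eq_continuous_at)
    then have "filterlim (\<lambda>y. \<rho> (r *\<^sub>R y) / c) (nhds (q r)) (nhds x)"
      using tendsto_at_iff_tendsto_nhds[of "\<lambda>y. \<rho> (r *\<^sub>R y) / c" x] by (simp add: isCont_def q_def)
    then show ?thesis using that topological_tendstoD by blast
  qed
  have "eventually (\<lambda>y. \<rho> ((1 + h) *\<^sub>R y) / c \<in> {0<..}) (nhds x)"
    by (rule ev) (use h d1(2)[of h] in auto)
  moreover have "eventually (\<lambda>y. \<rho> ((1 - h) *\<^sub>R y) / c \<in> {..<0}) (nhds x)"
    by (rule ev) (use h d2(2)[of h] in auto)
  moreover have "eventually (\<lambda>y. y \<in> B) (nhds x)"
    using AB by (intro eventually_nhds_in_open) auto
  ultimately show ?thesis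
  proof eventually_elim
    case (elim y)
    have "continuous_on {1-h..1+h} (\<lambda>r. \<rho> (r *\<^sub>R y) / c)"
      by (intro continuous_on_divide continuous_on_const c continuous_on_compose2[OF cont]
          continuous_intros) (use inW elim c in auto)
    then obtain r where r: "1 - h \<le> r" "r \<le> 1 + h" "\<rho> (r *\<^sub>R y) / c = 0"
      using IVT'[of "\<lambda>r. \<rho> (r *\<^sub>R y) / c" "1 - h" 0 "1 + h"] elim h by force
    have rpos: "r > 0" using r h by linarith
    have "r *\<^sub>R y \<in> H" using r zero[OF inW[of r y]] elim c by (auto simp: abs_le_iff)
    moreover have y: "y = (1 / r) *\<^sub>R r *\<^sub>R y" using rpos by simp
    ultimately have yU: "y \<in> U" and Fy: "F y = 1 / r"
      using scaleR_in_U[of "1/r" "r *\<^sub>R y"] F_ray[of "1/r" "r *\<^sub>R y"] rpos by auto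
    have "\<bar>F y - 1\<bar> = \<bar>1 - r\<bar> / r" using rpos by (simp add: Fy field_simps abs_if)
    also have "\<dots> \<le> h / (1 - h)" using r h by (intro frac_le) auto
    also have "\<dots> \<le> 2 * h"
    proof -
      have "h \<le> 2 * h * (1 - h)" using mult_left_mono[OF h(5), of h] h by (simp add: algebra_simps)
      then show ?thesis using h by (simp add: divide_le_eq)
    qed
    finally show ?case using yU h by linarith
  qed
qed

lemma open_U: "open U"
proof -
  have "\<exists>T. open T \<and> z \<in> T \<and> T \<subseteq> U" if "z \<in> U" for z
  proof -
    have r: "F z > 0" and x: "proj z \<in> H" using F_pos proj_in_H that by auto
    obtain T where T: "open T" "proj z \<in> T" "\<And>y. y \<in> T \<Longrightarrow> y \<in> U"
      using F_near_hypersurface[OF x, of 1] unfolding eventually_nhds by auto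
    have "open ((\<lambda>y. (1 / F z) *\<^sub>R y) -` T)"
      by (rule open_vimage[OF T(1)]) (intro continuous_intros)
    moreover have "y \<in> U" if "(1 / F z) *\<^sub>R y \<in> T" for y
      using U_scale(1)[OF T(3)[OF that] r] r by simp
    ultimately show ?thesis using T(2) unfolding proj_def by blast
  qed
  then show ?thesis by (subst open_subopen) blast
qed

lemma F_tendsto_1:
  assumes "x \<in> H" shows "(F \<longlongrightarrow> 1) (nhds x)"
  unfolding tendsto_iff dist_real_def
  by (intro allI impI, rule eventually_mono[OF F_near_hypersurface[OF assms]]) auto

text \<open>An implicit function argument by hand. For \<open>y\<close> near \<open>x\<close> the point
  \<open>proj y\<close> lies on \<open>H\<close> near \<open>x\<close>, so the normalized differential
  \<open>A\<close> of the defining function is small on \<open>proj y - x\<close>; multiplied by \<open>F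
  y\<close>, that value is \<open>1 + A (y - x) - F y\<close>, the negative of the error to be
  estimated.\<close>

lemma F_has_derivative_on_H:
  assumes ldf: "local_defining_function H W \<rho>" and x: "x \<in> H" "x \<in> W"
  shows "(F has_derivative (\<lambda>v. D \<rho> x v / D \<rho> x x)) (at x)"
proof -
  have op: "open W" and sm: "smooth_on W \<rho>" and zero: "\<And>y. y \<in> W \<Longrightarrow> y \<in> H \<longleftrightarrow> \<rho> y = 0"
    using ldf unfolding local_defining_function_def by auto
  define c where "c = D \<rho> x x"
  have c: "c \<noteq> 0" using defining_function_radial_derivative[OF ldf x] by (simp add: c_def)
  define A where "A = (\<lambda>v. D \<rho> x v / c)"
  have A': "((\<lambda>y. \<rho> y / c) has_derivative A) (at x)"
    unfolding A_def
    by (rule bounded_linear.has_derivative[OF bounded_linear_divide smooth_on_has_derivative[OF sm op x(2)]])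
  then have A: "bounded_linear A" by (rule has_derivative_bounded_linear)
  then have Alin: "linear A" by (rule bounded_linear.linear)
  have Ax: "A x = 1" using c by (simp add: A_def c_def)
  obtain B where B: "B > 0" "\<And>v. \<bar>A v\<bar> \<le> norm v * B"
    using bounded_linear.pos_bounded[OF A] by auto
  have "\<exists>d>0. \<forall>y. norm (y - x) < d \<longrightarrow> norm (F y - F x - A (y - x)) \<le> e * norm (y - x)"
    if e: "e > 0" for e
  proof -
    \<comment> \<open>The first bound absorbs the error term that reappears on the right-hand side, the
      second makes the remaining factor at most \<open>e\<close>.\<close>
    define e' where "e' = min (1 / (2 * (norm x + 1))) (e / (2 * (1 + B * norm x)))"
    have pos: "norm x + 1 > 0" "1 + B * norm x > 0"
      using B(1) by (auto intro: add_nonneg_pos add_pos_nonneg)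
    then have e'pos: "e' > 0" using e by (simp add: e'_def)
    have "e' * norm x \<le> 1 / (2 * (norm x + 1)) * norm x"
      by (intro mult_right_mono) (auto simp: e'_def)
    also have "\<dots> \<le> 1/2" using pos by (simp add: field_simps)
    finally have e'1: "e' * norm x \<le> 1/2" .
    have "e' \<le> e / (2 * (1 + B * norm x))" by (simp add: e'_def)
    then have e'2: "2 * e' * (1 + B * norm x) \<le> e"
      using pos by (simp add: pos_le_divide_eq ac_simps)
    obtain d where d: "d > 0" "\<And>z. norm (z - x) < d \<Longrightarrow> \<bar>\<rho> z / c - \<rho> x / c - A (z - x)\<bar> \<le> e' * norm (z - x)"
      using A' e'pos unfolding has_derivative_at_alt by (metis real_norm_def)
    have "((\<lambda>y. (1 / F y) *\<^sub>R y) \<longlongrightarrow> (1 / 1) *\<^sub>R x) (nhds x)"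
      by (intro tendsto_intros F_tendsto_1 x(1) filterlim_ident) auto
    then have "(proj \<longlongrightarrow> x) (nhds x)" by (simp add: proj_def[abs_def])
    then have "eventually (\<lambda>y. proj y \<in> W \<inter> ball x d) (nhds x)"
      by (rule topological_tendstoD) (use op x d in auto)
    moreover have "eventually (\<lambda>y. y \<in> U) (nhds x)"
      using open_U H_subset_U x by (intro eventually_nhds_in_open) auto
    ultimately have "eventually (\<lambda>y. norm (F y - F x - A (y - x)) \<le> e * norm (y - x)) (nhds x)"
    proof eventually_elim
      case (elim y)
      define N where "N = norm (y - x)"
      define E where "E = \<bar>F y - 1 - A (y - x)\<bar>"
      have Fpos: "F y > 0" using F_pos elim by simp
      have "\<rho> (proj y) = 0" "\<rho> x = 0"
        using zero[of "proj y"] zero[OF x(2)] proj_in_H elim x by auto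
      then have *: "\<bar>A (proj y - x)\<bar> \<le> e' * norm (proj y - x)"
        using d(2)[of "proj y"] elim by (simp add: dist_norm norm_minus_commute)
      have "F y *\<^sub>R (proj y - x) = (y - x) - (F y - 1) *\<^sub>R x"
        using Fpos by (simp add: proj_def algebra_simps)
      then have eq: "F y *\<^sub>R (proj y - x) = (y - x) - (F y - 1) *\<^sub>R x" .
      have "E = \<bar>A (F y *\<^sub>R (proj y - x))\<bar>"
        unfolding eq E_def using Ax by (simp add: linear_diff[OF Alin] linear_cmul[OF Alin])
      also have "\<dots> = F y * \<bar>A (proj y - x)\<bar>" using Fpos by (simp add: linear_cmul[OF Alin] abs_mult)
      also have "\<dots> \<le> F y * (e' * norm (proj y - x))" using * Fpos by (intro mult_left_mono) auto
      also have "\<dots> = e' * norm (F y *\<^sub>R (proj y - x))" using Fpos by simp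
      also have "\<dots> \<le> e' * (N + \<bar>F y - 1\<bar> * norm x)"
        unfolding eq N_def using e'pos norm_triangle_ineq4[of "y - x" "(F y - 1) *\<^sub>R x"]
        by (intro mult_left_mono) auto
      also have "\<dots> \<le> e' * (N + (E + N * B) * norm x)"
        using B(2)[of "y - x"] e'pos unfolding E_def N_def
        by (intro mult_left_mono add_left_mono mult_right_mono) auto
      also have "\<dots> = e' * N * (1 + B * norm x) + E * (e' * norm x)" by (simp add: algebra_simps)
      also have "\<dots> \<le> e' * N * (1 + B * norm x) + E * (1/2)"
        using e'1 by (intro add_left_mono mult_left_mono) (auto simp: E_def)
      finally have "E \<le> (2 * e' * (1 + B * norm x)) * N" by (simp add: algebra_simps)
      also have "\<dots> \<le> e * N" using e'2 by (intro mult_right_mono) (auto simp: N_def)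
      finally show ?case using F_eq_1[OF x(1)] by (simp add: E_def N_def)
    qed
    then show ?thesis by (simp add: eventually_nhds_metric dist_norm)
  qed
  then have "(F has_derivative A) (at x)"
    unfolding has_derivative_at_alt using A by blast
  then show ?thesis unfolding A_def c_def .
qed

lemma
  assumes "z \<in> U"
  shows F_has_derivative: "(F has_derivative D F z) (at z)"
    and D_F_proj: "D F z = D F (proj z)"
proof -
  define r where "r = F z"
  have r: "r > 0" using F_pos assms by (simp add: r_def)
  define x where "x = proj z"
  have xH: "x \<in> H" using proj_in_H assms by (simp add: x_def)
  obtain W \<rho> where W: "x \<in> W" and ldf: "local_defining_function H W \<rho>"
    using defining_function_at[OF xH] by blast
  have Fx: "(F has_derivative D F x) (at x)"
    using F_has_derivative_on_H[OF ldf xH W] by (metis frechet_derivative_at)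
  have lin: "linear (D F x)" using Fx by (rule has_derivative_linear)
  have "((\<lambda>y. (1 / r) *\<^sub>R y) has_derivative (\<lambda>v. (1 / r) *\<^sub>R v)) (at z)"
    by (auto intro!: derivative_eq_intros)
  moreover have "(F has_derivative D F x) (at ((1 / r) *\<^sub>R z))"
    using Fx by (simp add: x_def proj_def r_def)
  ultimately have "((\<lambda>y. F ((1 / r) *\<^sub>R y)) has_derivative (\<lambda>v. D F x ((1 / r) *\<^sub>R v))) (at z)"
    using diff_chain_at[of "\<lambda>y. (1 / r) *\<^sub>R y" _ z F] by (simp add: o_def)
  then have "((\<lambda>y. r * F ((1 / r) *\<^sub>R y)) has_derivative (\<lambda>v. r * D F x ((1 / r) *\<^sub>R v))) (at z)"
    by (rule has_derivative_mult_right)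
  then have "((\<lambda>y. r * F ((1 / r) *\<^sub>R y)) has_derivative D F x) (at z)"
    using r by (simp add: linear_cmul[OF lin])
  then have *: "(F has_derivative D F x) (at z)"
    by (rule has_derivative_transform_within_open[OF _ open_U assms]) (use r U_scale in auto)
  then have "D F z = D F x" by (metis frechet_derivative_at)
  then show "D F z = D F (proj z)" "(F has_derivative D F z) (at z)"
    using * by (simp_all add: x_def)
qed

lemma linear_D_F: "z \<in> U \<Longrightarrow> linear (D F z)"
  using F_has_derivative has_derivative_linear by blast

lemma D_F_on_H:
  assumes "local_defining_function H W \<rho>" and "x \<in> H" "x \<in> W"
  shows "D F x v = D \<rho> x v / D \<rho> x x"
  using fun_cong[OF frechet_derivative_at[OF F_has_derivative_on_H[OF assms]]] by simp

lemma tangent_space_eq_kernel: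
  assumes "x \<in> H" shows "tangent_space H x = {v. D F x v = 0}"
proof -
  obtain W \<rho> where W: "x \<in> W" and ldf: "local_defining_function H W \<rho>"
    using defining_function_at[OF assms] by blast
  show ?thesis
    using D_F_on_H[OF ldf assms W] defining_function_radial_derivative[OF ldf assms W] ldf assms W
    unfolding local_defining_function_def by auto
qed

lemma Euler_identity: assumes "z \<in> U" shows "D F z z = F z"
proof -
  have x: "proj z \<in> H" using proj_in_H assms .
  obtain W \<rho> where W: "proj z \<in> W" and ldf: "local_defining_function H W \<rho>"
    using defining_function_at[OF x] by blast
  have "D F z (proj z) = 1"
    using D_F_on_H[OF ldf x W] defining_function_radial_derivative[OF ldf x W]
    by (simp add: D_F_proj[OF assms])
  then show ?thesis
    using F_pos[OF assms] linear_D_F[OF assms] by (simp add: proj_def linear_cmul field_simps)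
qed

lemma continuous_F: "continuous_on U F"
  by (rule continuous_at_imp_continuous_on) (use F_has_derivative has_derivative_continuous in blast)

lemma continuous_proj: "continuous_on U proj"
  unfolding proj_def by (intro continuous_intros continuous_F) (use F_pos in force)

lemma tendsto_D_F:
  assumes "z \<in> U" "(a \<longlongrightarrow> z) L" "(b \<longlongrightarrow> w) L"
  shows "((\<lambda>s. D F (a s) (b s)) \<longlongrightarrow> D F z w) L"
proof -
  have "isCont (\<lambda>z. D F z w) z" if z: "z \<in> U" for z w
  proof -
    have x: "proj z \<in> H" using proj_in_H z .
    obtain W \<rho> where W: "proj z \<in> W" and ldf: "local_defining_function H W \<rho>"
      using defining_function_at[OF x] by blast
    have op: "open W" and sm: "smooth_on W \<rho>" using ldf unfolding local_defining_function_def by auto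
    have tp: "(proj \<longlongrightarrow> proj z) (at z)"
      using continuous_proj open_U z by (simp add: continuous_on_eq_continuous_at isCont_def)
    have lim: "((\<lambda>y. D \<rho> (proj y) w / D \<rho> (proj y) (proj y)) \<longlongrightarrow> D \<rho> (proj z) w / D \<rho> (proj z) (proj z)) (at z)"
      by (intro tendsto_divide tendsto_differential[OF op sm W] tp tendsto_const
          defining_function_radial_derivative[OF ldf x W])
    have "eventually (\<lambda>y. proj y \<in> W) (at z)"
      by (rule topological_tendstoD[OF tp op W])
    moreover have "eventually (\<lambda>y. y \<in> U) (at z)"
      using open_U z by (simp add: eventually_at_in_open')
    ultimately have "eventually (\<lambda>y. D \<rho> (proj y) w / D \<rho> (proj y) (proj y) = D F y w) (at z)"
      by eventually_elim (simp add: D_F_proj D_F_on_H[OF ldf] proj_in_H)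
    with lim have "((\<lambda>y. D F y w) \<longlongrightarrow> D \<rho> (proj z) w / D \<rho> (proj z) (proj z)) (at z)"
      by (rule Lim_transform_eventually)
    then show ?thesis
      unfolding isCont_def using D_F_proj[OF z] D_F_on_H[OF ldf x W] by simp
  qed
  then show ?thesis
    by (intro tendsto_linear_functional_field[OF open_U assms(1) _ _ assms(2,3)])
      (auto simp: linear_D_F intro: continuous_at_imp_continuous_on)
qed

lemma metric_homogeneous:
  assumes "x \<in> H" "v \<in> tangent_space H x"
  shows "centroaffine_metric H x (c *\<^sub>R v) (c *\<^sub>R v) = c\<^sup>2 * centroaffine_metric H x v v"
proof -
  obtain W \<rho> where W: "x \<in> W" and ldf: "local_defining_function H W \<rho>"
    using defining_function_at[OF assms(1)] by blast
  have op: "open W" and sm: "smooth_on W \<rho>" using ldf unfolding local_defining_function_def by auto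
  have lin: "linear (D (\<lambda>z. D \<rho> z i) x)" for i
    by (rule has_derivative_linear[OF smooth_on_has_derivative[OF smooth_on_derivative[OF sm] op W]])
  have "c *\<^sub>R v \<in> tangent_space H x"
    using assms linear_D_F[OF H_subset_U] by (simp add: tangent_space_eq_kernel linear_cmul)
  moreover have "D2 \<rho> x (c *\<^sub>R v) (c *\<^sub>R v) = c\<^sup>2 * D2 \<rho> x v v"
    by (simp add: D2_def linear_cmul[OF lin] sum_distrib_left power2_eq_square ac_simps)
  ultimately show ?thesis
    by (simp add: centroaffine_metric_eq[OF centroaffine ldf assms(1) W] assms(2))
qed

text \<open>Continuity of the metric on the tangent bundle, stated with filters so that it applies to
  projected segments as well as to compact sets of unit tangent vectors.\<close>

lemma tendsto_metric:
  assumes "x \<in> H" "v \<in> tangent_space H x" "(a \<longlongrightarrow> x) L" "(b \<longlongrightarrow> v) L"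
    and ev: "eventually (\<lambda>s. a s \<in> H \<and> b s \<in> tangent_space H (a s)) L"
  shows "((\<lambda>s. centroaffine_metric H (a s) (b s) (b s)) \<longlongrightarrow> centroaffine_metric H x v v) L"
proof -
  obtain W \<rho> where W: "x \<in> W" and ldf: "local_defining_function H W \<rho>"
    using defining_function_at[OF assms(1)] by blast
  have op: "open W" and sm: "smooth_on W \<rho>" using ldf unfolding local_defining_function_def by auto
  have "((\<lambda>s. - D2 \<rho> (a s) (b s) (b s) / D \<rho> (a s) (a s)) \<longlongrightarrow> - D2 \<rho> x v v / D \<rho> x x) L"
    unfolding D2_def
    by (intro tendsto_divide tendsto_minus tendsto_sum tendsto_mult tendsto_inner tendsto_const
        tendsto_differential[OF op sm W] tendsto_differential[OF op smooth_on_derivative[OF sm] W]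
        assms defining_function_radial_derivative[OF ldf _ W])
  moreover have "eventually (\<lambda>s. - D2 \<rho> (a s) (b s) (b s) / D \<rho> (a s) (a s) =
      centroaffine_metric H (a s) (b s) (b s)) L"
    using topological_tendstoD[OF assms(3) op W] ev
    by eventually_elim (use centroaffine_metric_eq[OF centroaffine ldf] in simp)
  ultimately show ?thesis
    unfolding centroaffine_metric_eq[OF centroaffine ldf assms(1) W assms(2,2)]
    by (rule Lim_transform_eventually)
qed

text \<open>The Gauss formula along a curve: the position component of the acceleration is the metric
  applied to the velocity.\<close>

lemma metric_eq_acceleration:
  assumes e: "e > 0" and inH: "\<And>t. \<bar>t\<bar> < e \<Longrightarrow> \<gamma> t \<in> H"
    and \<gamma>': "\<And>t. \<bar>t\<bar> < e \<Longrightarrow> (\<gamma> has_vector_derivative \<gamma>' t) (at t)"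
    and a: "(\<gamma>' has_vector_derivative a) (at (0::real))"
  shows "\<gamma>' 0 \<in> tangent_space H (\<gamma> 0)"
    and "D F (\<gamma> 0) a = centroaffine_metric H (\<gamma> 0) (\<gamma>' 0) (\<gamma>' 0)"
proof -
  have x: "\<gamma> 0 \<in> H" using inH e by simp
  obtain W \<rho> where W: "\<gamma> 0 \<in> W" and ldf: "local_defining_function H W \<rho>"
    using defining_function_at[OF x] by blast
  have tan: "\<gamma>' t \<in> tangent_space H (\<gamma> t)" if "\<bar>t\<bar> < e" for t
  proof -
    have "eventually (\<lambda>s. s \<in> {-e<..<e}) (nhds t)"
      using that by (intro eventually_nhds_in_open) (auto simp: abs_less_iff)
    then have "eventually (\<lambda>s. F (\<gamma> s) = 1) (nhds t)"
      by (rule eventually_mono) (use inH F_eq_1 in auto)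
    then show ?thesis
      using derivative_along_curve_in_zero_set[OF F_has_derivative[OF H_subset_U] \<gamma>'[OF that]] inH[OF that]
      by (simp add: tangent_space_eq_kernel)
  qed
  then show v: "\<gamma>' 0 \<in> tangent_space H (\<gamma> 0)" using e by simp
  have "eventually (\<lambda>s. s \<in> {-e<..<e}) (nhds 0)"
    using e by (intro eventually_nhds_in_open) auto
  then have "eventually (\<lambda>s. \<gamma> s \<in> H \<and> \<gamma>' s \<in> tangent_space H (\<gamma> s)) (nhds 0)"
    by (rule eventually_mono) (use inH tan in \<open>auto simp: abs_less_iff\<close>)
  from differential_of_tangent_field_derivative[OF ldf W \<gamma>' a this] e
  have "D \<rho> (\<gamma> 0) a = - D2 \<rho> (\<gamma> 0) (\<gamma>' 0) (\<gamma>' 0)" by simp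
  then show "D F (\<gamma> 0) a = centroaffine_metric H (\<gamma> 0) (\<gamma>' 0) (\<gamma>' 0)"
    by (simp add: D_F_on_H[OF ldf x W] centroaffine_metric_eq[OF centroaffine ldf x W v v])
qed

lemma tangent_vector_accelerated_curve:
  assumes "x \<in> H" "v \<in> tangent_space H x"
  obtains \<gamma> \<gamma>' a e where "e > 0" "\<And>t. \<bar>t\<bar> < e \<Longrightarrow> \<gamma> t \<in> H"
    "\<And>t. \<bar>t\<bar> < e \<Longrightarrow> (\<gamma> has_vector_derivative \<gamma>' t) (at t)"
    "(\<gamma>' has_vector_derivative a) (at (0::real))" "\<gamma> 0 = x" "\<gamma>' 0 = v"
proof -
  obtain \<gamma> e where \<gamma>: "e > 0" "\<And>t. -e < t \<Longrightarrow> t < e \<Longrightarrow> \<gamma> t \<in> H" "\<gamma> 0 = x"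
      "(\<gamma> has_vector_derivative v) (at (0::real))" and sm\<gamma>: "smooth_on {-e<..<e} \<gamma>"
    using tangent_spaceE[OF assms(2)] by blast
  define \<gamma>' where "\<gamma>' = (\<lambda>t. D \<gamma> t 1)"
  have vd: "(f has_vector_derivative D f t 1) (at t)"
    if "smooth_on {-e<..<e} f" "\<bar>t\<bar> < e" for f :: "real \<Rightarrow> 'a" and t
  proof -
    have f: "(f has_derivative D f t) (at t)"
      by (rule smooth_on_has_derivative[OF that(1)]) (use that(2) in \<open>auto simp: abs_less_iff\<close>)
    have "D f t s = s *\<^sub>R D f t 1" for s
      using linear_cmul[OF has_derivative_linear[OF f], of s 1] by simp
    then have "D f t = (\<lambda>s. s *\<^sub>R D f t 1)" by blast
    with f show ?thesis unfolding has_vector_derivative_def by simp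
  qed
  have \<gamma>': "(\<gamma> has_vector_derivative \<gamma>' t) (at t)" if "\<bar>t\<bar> < e" for t
    unfolding \<gamma>'_def by (rule vd[OF sm\<gamma> that])
  have \<gamma>'0: "\<gamma>' 0 = v" using \<gamma>'[of 0] \<gamma>(1,4) by (auto intro: vector_derivative_unique_at)
  have a: "(\<gamma>' has_vector_derivative D \<gamma>' 0 1) (at 0)"
    by (rule vd) (use smooth_on_derivative[OF sm\<gamma>] \<gamma>(1) in \<open>auto simp: \<gamma>'_def\<close>)
  show thesis
    by (rule that[OF \<gamma>(1) _ \<gamma>' a \<gamma>(3) \<gamma>'0]) (use \<gamma>(2) in \<open>auto simp: abs_less_iff\<close>)
qed

end

section \<open>Riemannian distances on a hypersurface with convex cone\<close>

lemma DERIV_max_0_square: "((\<lambda>s::real. (max 0 s)\<^sup>2) has_real_derivative 2 * max 0 s) (at s)"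
proof (cases s "0::real" rule: linorder_cases)
  case less
  then have "eventually (\<lambda>t. (max 0 t)\<^sup>2 = 0) (nhds s)"
    using eventually_nhds_in_open[of "{..<0}" s] by (auto elim!: eventually_mono simp: max_def)
  then show ?thesis
    using less DERIV_cong_ev[OF refl, of "\<lambda>t. (max 0 t)\<^sup>2" "\<lambda>t. 0" s "2 * max 0 s" "2 * max 0 s"]
    by auto
next
  case greater
  then have "eventually (\<lambda>t. (max 0 t)\<^sup>2 = t\<^sup>2) (nhds s)"
    using eventually_nhds_in_open[of "{0<..}" s] by (auto elim!: eventually_mono simp: max_def)
  then show ?thesis
    using greater DERIV_cong_ev[OF refl, of "\<lambda>t. (max 0 t)\<^sup>2" "\<lambda>t. t\<^sup>2" s "2 * max 0 s" "2 * max 0 s"]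
    by (auto intro!: derivative_eq_intros)
next
  case equal
  have "((\<lambda>h::real. (max 0 h)\<^sup>2 / h) \<longlongrightarrow> 0) (at 0)"
  proof (rule Lim_null_comparison[where g = "\<lambda>h. \<bar>h\<bar>"])
    show "eventually (\<lambda>h::real. norm ((max 0 h)\<^sup>2 / h) \<le> \<bar>h\<bar>) (at 0)"
      by (rule always_eventually) (auto simp: max_def power2_eq_square)
    show "((\<lambda>h::real. \<bar>h\<bar>) \<longlongrightarrow> 0) (at 0)" by (rule tendsto_eq_intros refl | simp)+
  qed
  then show ?thesis using equal by (simp add: DERIV_def)
qed

text \<open>The metric is a parameter because both the Euclidean and the centroaffine distance are needed.
  Lengths depend only on the quadratic form on tangent vectors, so the conditions speak of it alone. An
  assumption of a locale cannot quantify over the type of the parameter \<open>s\<close>; pairs of a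
  position and a direction serve both for projected segments and for sets of unit tangent vectors.\<close>

locale riemannian_hypersurface = radial_hypersurface H F
  for H :: "'a::euclidean_space set" and F +
  fixes G :: "'a \<Rightarrow> 'a \<Rightarrow> 'a \<Rightarrow> real"
  assumes convex_U: "convex U"
    and G_homogeneous: "x \<in> H \<Longrightarrow> v \<in> tangent_space H x \<Longrightarrow> G x (c *\<^sub>R v) (c *\<^sub>R v) = c\<^sup>2 * G x v v"
    and G_pos: "x \<in> H \<Longrightarrow> v \<in> tangent_space H x \<Longrightarrow> v \<noteq> 0 \<Longrightarrow> G x v v > 0"
    and G_tendsto: "x \<in> H \<Longrightarrow> v \<in> tangent_space H x \<Longrightarrow> (a \<longlongrightarrow> x) L \<Longrightarrow> (b \<longlongrightarrow> v) L \<Longrightarrow>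
        eventually (\<lambda>s. a s \<in> H \<and> b s \<in> tangent_space H (a s)) L \<Longrightarrow>
        ((\<lambda>s :: 'a \<times> 'a. G (a s) (b s) (b s)) \<longlongrightarrow> G x v v) L"
begin

abbreviation speed :: "(real \<Rightarrow> 'a) \<Rightarrow> real \<Rightarrow> real" where
  "speed \<gamma> t \<equiv> sqrt (G (\<gamma> t) (vector_derivative \<gamma> (at t)) (vector_derivative \<gamma> (at t)))"

abbreviation d :: "'a \<Rightarrow> 'a \<Rightarrow> real" where "d \<equiv> riemannian_dist H G"

lemma zero_tangent: "x \<in> H \<Longrightarrow> 0 \<in> tangent_space H x"
  using linear_0[OF linear_D_F[OF H_subset_U]] by (simp add: tangent_space_eq_kernel)

lemma G_zero: "x \<in> H \<Longrightarrow> G x 0 0 = 0"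
  using G_homogeneous[OF _ zero_tangent, of x 0] by simp

lemma G_nonneg: "x \<in> H \<Longrightarrow> v \<in> tangent_space H x \<Longrightarrow> G x v v \<ge> 0"
  using G_pos[of x v] G_zero[of x] by (cases "v = 0") auto

lemma sqrt_G_scale:
  "x \<in> H \<Longrightarrow> v \<in> tangent_space H x \<Longrightarrow> sqrt (G x (c *\<^sub>R v) (c *\<^sub>R v)) = \<bar>c\<bar> * sqrt (G x v v)"
  by (simp add: G_homogeneous real_sqrt_mult)

text \<open>The set \<open>S\<close> collects the finitely many exceptional parameters of a piecewise smooth
  curve. It contains the end points, where the two-sided derivative says nothing because the curve is not
  controlled outside the unit interval.\<close>

lemma curve_lengthsE:
  assumes "L \<in> curve_lengths H G x y"
  obtains \<gamma> S where "valid_path \<gamma>" "path_image \<gamma> \<subseteq> H" "pathstart \<gamma> = x" "pathfinish \<gamma> = y"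
    "(speed \<gamma> has_integral L) {0..1}" "finite S" "0 \<in> S" "1 \<in> S"
    "\<And>t. t \<in> {0..1} - S \<Longrightarrow> (\<gamma> has_vector_derivative vector_derivative \<gamma> (at t)) (at t)"
    "\<And>t. t \<in> {0..1} - S \<Longrightarrow> vector_derivative \<gamma> (at t) \<in> tangent_space H (\<gamma> t)"
    "\<And>t. t \<in> {0..1} \<Longrightarrow> \<gamma> t \<in> H" "continuous_on {0..1} \<gamma>"
proof -
  obtain \<gamma> where \<gamma>: "valid_path \<gamma>" "path_image \<gamma> \<subseteq> H" "pathstart \<gamma> = x" "pathfinish \<gamma> = y"
    "(speed \<gamma> has_integral L) {0..1}"
    using assms unfolding curve_lengths_def by blast
  obtain S0 where S0: "finite S0" "\<gamma> C1_differentiable_on {0..1} - S0" "continuous_on {0..1} \<gamma>"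
    using \<gamma>(1) unfolding valid_path_def piecewise_C1_differentiable_on_def by blast
  define S where "S = insert 0 (insert 1 S0)"
  have der: "(\<gamma> has_vector_derivative vector_derivative \<gamma> (at t)) (at t)" if "t \<in> {0..1} - S" for t
    using S0(2) that unfolding C1_differentiable_on_eq S_def
    by (auto simp: vector_derivative_works[symmetric])
  have inH: "\<gamma> t \<in> H" if "t \<in> {0..1}" for t
    using \<gamma>(2) that unfolding path_image_def by blast
  have tan: "vector_derivative \<gamma> (at t) \<in> tangent_space H (\<gamma> t)" if "t \<in> {0..1} - S" for t
  proof -
    have t: "t \<in> {0<..<1}" using that unfolding S_def by auto
    then have "eventually (\<lambda>s. s \<in> {0<..<1}) (nhds t)"
      by (intro eventually_nhds_in_open) auto
    then have "eventually (\<lambda>s. F (\<gamma> s) = 1) (nhds t)"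
      by (rule eventually_mono) (use inH F_eq_1 in auto)
    then have "D F (\<gamma> t) (vector_derivative \<gamma> (at t)) = 0"
      using derivative_along_curve_in_zero_set[OF F_has_derivative[OF H_subset_U] der[OF that]]
        inH t by simp
    then show ?thesis using inH t by (simp add: tangent_space_eq_kernel)
  qed
  show thesis
    by (rule that[OF \<gamma>, of S]) (use S0 der inH tan in \<open>auto simp: S_def\<close>)
qed

text \<open>All lower bounds for distances are obtained from this by a choice of \<open>u\<close>: a linear
  functional compares with the Euclidean norm, a bump function separates points, and the logarithm of a
  linear functional bounds Cauchy sequences.\<close>

lemma increment_le_length:
  assumes "L \<in> curve_lengths H G x y"
    and u': "\<And>z. z \<in> H \<Longrightarrow> (u has_derivative u' z) (at z)"
    and C: "\<And>z v. z \<in> H \<Longrightarrow> v \<in> tangent_space H z \<Longrightarrow> \<bar>u' z v\<bar> \<le> C * sqrt (G z v v)"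
  shows "\<bar>u y - u x\<bar> \<le> C * L"
proof -
  obtain \<gamma> S where "valid_path \<gamma>" "path_image \<gamma> \<subseteq> H" and \<gamma>: "pathstart \<gamma> = x" "pathfinish \<gamma> = y"
    "(speed \<gamma> has_integral L) {0..1}" "finite S" "0 \<in> S" "1 \<in> S"
    and der: "\<And>t. t \<in> {0..1} - S \<Longrightarrow> (\<gamma> has_vector_derivative vector_derivative \<gamma> (at t)) (at t)"
    and tan: "\<And>t. t \<in> {0..1} - S \<Longrightarrow> vector_derivative \<gamma> (at t) \<in> tangent_space H (\<gamma> t)"
    and inH: "\<And>t. t \<in> {0..1} \<Longrightarrow> \<gamma> t \<in> H" and cont: "continuous_on {0..1} \<gamma>"
    by (rule curve_lengthsE[OF assms(1)]) (rule that)
  let ?p = "\<lambda>t. if t \<in> S then 0 else u' (\<gamma> t) (vector_derivative \<gamma> (at t))"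
  let ?q = "\<lambda>t. if t \<in> S then 0 else C * speed \<gamma> t"
  have "continuous_on H u"
    using u' has_derivative_continuous by (metis continuous_at_imp_continuous_on)
  then have "continuous_on {0..1} (\<lambda>t. u (\<gamma> t))"
    by (rule continuous_on_compose2[OF _ cont]) (use inH in auto)
  moreover have "((\<lambda>t. u (\<gamma> t)) has_vector_derivative ?p t) (at t)" if "t \<in> {0<..<1} - S" for t
  proof -
    have t: "t \<in> {0..1} - S" using that by auto
    have "(u has_derivative u' (\<gamma> t)) (at (\<gamma> t))" using u' inH t by blast
    from vector_derivative_diff_chain_within[OF der[OF t] has_derivative_at_withinI[OF this]]
    show ?thesis using t by (simp add: o_def)
  qed
  ultimately have "(?p has_integral u (\<gamma> 1) - u (\<gamma> 0)) {0..1}"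
    using \<gamma>(4) by (intro fundamental_theorem_of_calculus_interior_strong[of S]) auto
  then have p: "(?p has_integral u y - u x) {0..1}"
    using \<gamma>(1,2) by (simp add: pathstart_def pathfinish_def)
  have q: "(?q has_integral C * L) {0..1}"
    by (rule has_integral_spike_finite[OF \<gamma>(4) _ has_integral_mult_right[OF \<gamma>(3)]]) auto
  have le: "\<bar>?p t\<bar> \<le> ?q t" if "t \<in> {0..1}" for t
    using C[OF inH tan] that by auto
  have "u y - u x \<le> C * L"
    by (rule has_integral_le[OF p q]) (use le in fastforce)
  moreover have "- (u y - u x) \<le> C * L"
    by (rule has_integral_le[OF has_integral_neg[OF p] q]) (use le in fastforce)
  ultimately show ?thesis by linarith
qed

lemma length_nonneg: "L \<in> curve_lengths H G x y \<Longrightarrow> L \<ge> 0"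
  using increment_le_length[of L x y "\<lambda>_. 0" "\<lambda>_ _. 0" 1] G_nonneg by simp

lemma dist_le_length: "L \<in> curve_lengths H G x y \<Longrightarrow> d x y \<le> L"
  using cInf_lower[of L "curve_lengths H G x y"] bdd_belowI[of "curve_lengths H G x y" 0] length_nonneg
  unfolding riemannian_dist_def by auto

lemma dist_nonneg: "d x y \<ge> 0"
proof (cases "curve_lengths H G x y = {}")
  case False
  then show ?thesis
    unfolding riemannian_dist_def using cInf_greatest[OF False, of 0] length_nonneg by auto
qed (simp add: riemannian_dist_def)

section \<open>Radially projected segments\<close>

definition D_proj :: "'a \<Rightarrow> 'a \<Rightarrow> 'a" where
  "D_proj z w = (1 / F z) *\<^sub>R w - (D F z w / (F z)\<^sup>2) *\<^sub>R z"

lemma proj_has_derivative: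
  assumes "z \<in> U" shows "(proj has_derivative D_proj z) (at z)"
proof -
  have F: "(F has_derivative D F z) (at z)" "F z \<noteq> 0" using F_has_derivative F_pos assms by force+
  have "((\<lambda>z. inverse (F z) *\<^sub>R z) has_derivative
      (\<lambda>w. inverse (F z) *\<^sub>R w + - (inverse (F z) * D F z w * inverse (F z)) *\<^sub>R z)) (at z)"
    by (rule has_derivative_scaleR[OF Deriv.has_derivative_inverse[OF F(2,1)] has_derivative_ident])
  then show ?thesis
    unfolding proj_def[abs_def] D_proj_def[abs_def] using F(2)
    by (simp add: inverse_eq_divide power2_eq_square)
qed

lemma D_proj_tangent:
  assumes "z \<in> U" shows "D_proj z w \<in> tangent_space H (proj z)"
proof -
  have "D F z (D_proj z w) = 0"
    unfolding D_proj_def using F_pos[OF assms] 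
    by (simp add: linear_diff[OF linear_D_F[OF assms]] linear_cmul[OF linear_D_F[OF assms]]
        Euler_identity[OF assms] power2_eq_square)
  then show ?thesis
    by (simp add: tangent_space_eq_kernel proj_in_H assms D_F_proj[symmetric])
qed

lemma tendsto_proj: "z \<in> U \<Longrightarrow> (a \<longlongrightarrow> z) L \<Longrightarrow> ((\<lambda>s. proj (a s)) \<longlongrightarrow> proj z) L"
  using continuous_proj open_U by (metis continuous_on_eq_continuous_at isCont_tendsto_compose)

lemma tendsto_F: "z \<in> U \<Longrightarrow> (a \<longlongrightarrow> z) L \<Longrightarrow> ((\<lambda>s. F (a s)) \<longlongrightarrow> F z) L"
  using continuous_F open_U by (metis continuous_on_eq_continuous_at isCont_tendsto_compose)

lemma tendsto_D_proj:
  assumes "z \<in> U" "(a \<longlongrightarrow> z) L" "(b \<longlongrightarrow> w) L"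
  shows "((\<lambda>s. D_proj (a s) (b s)) \<longlongrightarrow> D_proj z w) L"
  unfolding D_proj_def
  by (intro tendsto_intros tendsto_F tendsto_D_F assms) (use F_pos[OF assms(1)] in auto)

lemma tendsto_projected_speed:
  assumes "z \<in> U"
  shows "((\<lambda>(z, w). sqrt (G (proj z) (D_proj z w) (D_proj z w))) \<longlongrightarrow>
      sqrt (G (proj z) (D_proj z w) (D_proj z w))) (nhds (z, w))"
proof -
  have t: "(fst \<longlongrightarrow> z) (nhds (z, w))" "(snd \<longlongrightarrow> w) (nhds (z, w))"
    using tendsto_fst[OF filterlim_ident, of "(z, w)"] tendsto_snd[OF filterlim_ident, of "(z, w)"]
    by (simp_all add: filterlim_def)
  have "eventually (\<lambda>s. fst s \<in> U) (nhds (z, w))"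
    by (rule topological_tendstoD[OF t(1) open_U assms])
  then have "eventually (\<lambda>s. proj (fst s) \<in> H \<and> D_proj (fst s) (snd s) \<in> tangent_space H (proj (fst s))) (nhds (z, w))"
    by (rule eventually_mono) (simp add: proj_in_H D_proj_tangent)
  then show ?thesis
    unfolding split_beta
    by (intro tendsto_real_sqrt G_tendsto tendsto_proj tendsto_D_proj t assms proj_in_H D_proj_tangent)
qed

lemma linepath_in_U: "a \<in> U \<Longrightarrow> b \<in> U \<Longrightarrow> t \<in> {0..1} \<Longrightarrow> linepath a b t \<in> U"
  using convex_contains_segment[of U] convex_U linepath_in_path by blast

text \<open>Convexity of the cone supplies curves: the radial projection of a segment joins any two points
  of \<open>H\<close>. The end points are taken in the cone, not on \<open>H\<close>, so that pieces of one
  fixed segment can be projected, too.\<close>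

lemma projected_segment:
  assumes ab: "a \<in> U" "b \<in> U"
  obtains L where "L \<in> curve_lengths H G (proj a) (proj b)"
    "((\<lambda>t. sqrt (G (proj (linepath a b t)) (D_proj (linepath a b t) (b - a)) (D_proj (linepath a b t) (b - a))))
       has_integral L) {0..1}"
proof -
  define \<gamma> where "\<gamma> = (\<lambda>t. proj (linepath a b t))"
  have z: "linepath a b t \<in> U" if "t \<in> {0..1}" for t
    using linepath_in_U[OF ab that] .
  have der: "(\<gamma> has_vector_derivative D_proj (linepath a b t) (b - a)) (at t)" if "t \<in> {0..1}" for t
  proof -
    have "(linepath a b has_vector_derivative (b - a)) (at t)"
      using has_vector_derivative_linepath_within by blast
    from vector_derivative_diff_chain_within[OF this has_derivative_at_withinI[OF proj_has_derivative[OF z[OF that]]]]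
    show ?thesis by (simp add: o_def \<gamma>_def)
  qed
  have vd: "vector_derivative \<gamma> (at t) = D_proj (linepath a b t) (b - a)" if "t \<in> {0..1}" for t
    using der[OF that] by (rule vector_derivative_at)
  have lin: "((\<lambda>t. linepath a b t) \<longlongrightarrow> linepath a b t) (at t within {0..1})" for t
    using continuous_linepath_at[of t a b] continuous_at_imp_continuous_at_within
    unfolding continuous_within by blast
  have "continuous_on {0..1} (\<lambda>t. D_proj (linepath a b t) (b - a))"
    unfolding continuous_on_def by (intro ballI tendsto_D_proj z lin tendsto_const)
  then have "continuous_on {0..1} (\<lambda>t. vector_derivative \<gamma> (at t))"
    by (rule continuous_on_eq) (simp add: vd)
  then have "\<gamma> C1_differentiable_on {0..1}"
    unfolding C1_differentiable_on_eq using der differentiableI_vector by blast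
  then have vp: "valid_path \<gamma>"
    unfolding valid_path_def by (rule C1_differentiable_imp_piecewise)
  have ends: "pathstart \<gamma> = proj a" "pathfinish \<gamma> = proj b"
    by (auto simp: pathstart_def pathfinish_def \<gamma>_def linepath_def)
  have im: "path_image \<gamma> \<subseteq> H"
    unfolding path_image_def \<gamma>_def using z proj_in_H by auto
  let ?f = "\<lambda>t. sqrt (G (proj (linepath a b t)) (D_proj (linepath a b t) (b - a)) (D_proj (linepath a b t) (b - a)))"
  have "continuous_on {0..1} ?f"
    unfolding continuous_on_def
  proof
    fix t :: real assume t: "t \<in> {0..1}"
    have "((\<lambda>t. (linepath a b t, b - a)) \<longlongrightarrow> (linepath a b t, b - a)) (at t within {0..1})"
      by (intro tendsto_Pair lin tendsto_const)
    from filterlim_compose[OF tendsto_projected_speed[OF z[OF t]] this]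
    show "(?f \<longlongrightarrow> ?f t) (at t within {0..1})" by simp
  qed
  then have int: "(?f has_integral integral {0..1} ?f) {0..1}"
    by (intro integrable_integral integrable_continuous_real)
  have "(speed \<gamma> has_integral integral {0..1} ?f) {0..1}"
    by (rule has_integral_eq[OF _ int]) (simp add: vd, simp add: \<gamma>_def)
  then have "integral {0..1} ?f \<in> curve_lengths H G (proj a) (proj b)"
    unfolding curve_lengths_def using vp im ends by blast
  then show thesis using that int by blast
qed

lemma curve_lengths_nonempty:
  assumes "x \<in> H" "y \<in> H" shows "curve_lengths H G x y \<noteq> {}"
proof -
  obtain L where "L \<in> curve_lengths H G (proj x) (proj y)"
    using projected_segment[OF assms[THEN H_subset_U]] by blast
  then show ?thesis using proj_fixes_H assms by auto
qed

lemma increment_le_dist: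
  assumes "x \<in> H" "y \<in> H" "C > 0"
    and "\<And>z. z \<in> H \<Longrightarrow> (u has_derivative u' z) (at z)"
    and "\<And>z v. z \<in> H \<Longrightarrow> v \<in> tangent_space H z \<Longrightarrow> \<bar>u' z v\<bar> \<le> C * sqrt (G z v v)"
  shows "\<bar>u y - u x\<bar> \<le> C * d x y"
proof -
  have "\<bar>u y - u x\<bar> / C \<le> L" if "L \<in> curve_lengths H G x y" for L
    using increment_le_length[OF that assms(4,5)] assms(3) by (simp add: field_simps)
  then have "\<bar>u y - u x\<bar> / C \<le> d x y"
    using cInf_greatest[OF curve_lengths_nonempty[OF assms(1,2)], of "\<bar>u y - u x\<bar> / C"]
      curve_lengths_nonempty[OF assms(1,2)] unfolding riemannian_dist_def
    by simp
  then show ?thesis using assms(3) by (simp add: field_simps)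
qed

text \<open>The speed of the projected segment from \<open>x\<close> to \<open>y\<close> is a continuous
  function of position and direction that vanishes for direction zero, hence is uniformly small when
  \<open>y\<close> is close to \<open>x\<close>.\<close>

lemma dist_small:
  assumes "x \<in> H" "\<eta> > 0"
  shows "\<exists>\<delta>>0. \<forall>y\<in>H. dist y x < \<delta> \<longrightarrow> d x y \<le> \<eta>"
proof -
  have "D_proj x 0 = 0"
    using linear_0[OF linear_D_F[OF H_subset_U[OF assms(1)]]] by (simp add: D_proj_def)
  then have small: "sqrt (G (proj x) (D_proj x 0) (D_proj x 0)) < \<eta>"
    using G_zero[OF proj_in_H[OF H_subset_U[OF assms(1)]]] assms(2) by simp
  have "eventually (\<lambda>(z, w). sqrt (G (proj z) (D_proj z w) (D_proj z w)) < \<eta>) (nhds (x, 0))"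
    using order_tendstoD(2)[OF tendsto_projected_speed[OF H_subset_U[OF assms(1)], of 0] small]
    unfolding split_beta .
  then obtain e where e: "e > 0" "\<And>z w. dist (z, w) (x, 0) < e \<Longrightarrow> sqrt (G (proj z) (D_proj z w) (D_proj z w)) < \<eta>"
    unfolding eventually_nhds_metric by auto
  have "d x y \<le> \<eta>" if y: "y \<in> H" "dist y x < e / 2" for y
  proof -
    let ?f = "\<lambda>t. sqrt (G (proj (linepath x y t)) (D_proj (linepath x y t) (y - x)) (D_proj (linepath x y t) (y - x)))"
    obtain L where L: "L \<in> curve_lengths H G x y" "(?f has_integral L) {0..1}"
      using projected_segment[OF assms(1)[THEN H_subset_U] y(1)[THEN H_subset_U]]
      unfolding proj_fixes_H[OF assms(1)] proj_fixes_H[OF y(1)] by blast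
    have "?f t \<le> \<eta>" if t: "t \<in> {0..1}" for t
    proof -
      have "linepath x y t - x = t *\<^sub>R (y - x)" by (simp add: linepath_def algebra_simps)
      then have "dist (linepath x y t) x \<le> dist y x"
        using t by (simp add: dist_norm mult_left_le_one_le)
      moreover have "dist (linepath x y t, y - x) (x, 0) \<le> dist (linepath x y t) x + dist (y - x) 0"
        by (simp add: dist_Pair_Pair sqrt_sum_squares_le_sum)
      ultimately have "dist (linepath x y t, y - x) (x, 0) < e"
        using y(2) by (simp add: dist_norm)
      from e(2)[OF this] show ?thesis by simp
    qed
    then have "L \<le> \<eta>"
      using has_integral_le[OF L(2) has_integral_const_real[of \<eta> 0 1]] by simp
    then show ?thesis using dist_le_length[OF L(1)] by linarith
  qed
  then show ?thesis using e(1) by (intro exI[of _ "e / 2"]) auto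
qed

section \<open>The axioms of a metric\<close>

lemma curve_lengths_reverse:
  assumes "L \<in> curve_lengths H G x y"
  shows "L \<in> curve_lengths H G y x"
proof -
  obtain \<gamma> S where vp: "valid_path \<gamma>" "path_image \<gamma> \<subseteq> H" and ends: "pathstart \<gamma> = x" "pathfinish \<gamma> = y"
    and int: "(speed \<gamma> has_integral L) {0..1}" and S: "finite S" "0 \<in> S" "1 \<in> S"
    and der: "\<And>t. t \<in> {0..1} - S \<Longrightarrow> (\<gamma> has_vector_derivative vector_derivative \<gamma> (at t)) (at t)"
    and tan: "\<And>t. t \<in> {0..1} - S \<Longrightarrow> vector_derivative \<gamma> (at t) \<in> tangent_space H (\<gamma> t)"
    and inH: "\<And>t. t \<in> {0..1} \<Longrightarrow> \<gamma> t \<in> H" and cont: "continuous_on {0..1} \<gamma>"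
    by (rule curve_lengthsE[OF assms(1)]) (rule that)
  have "((\<lambda>t. speed \<gamma> (1 - t)) has_integral L) {0..1}"
    using has_integral_affinity01[OF int, of "-1" 1] by simp
  then have "(speed (reversepath \<gamma>) has_integral L) {0..1}"
  proof (rule has_integral_spike_finite[rotated 2])
    show "finite ((-) 1 ` S)" using S by simp
    fix t :: real assume t: "t \<in> {0..1} - (-) 1 ` S"
    then have t': "1 - t \<in> {0..1} - S" by (auto simp: image_iff)
    have "((\<lambda>t. 1 - t) has_vector_derivative - 1) (at t)" by (auto intro!: derivative_eq_intros)
    from vector_diff_chain_at[OF this der[OF t']]
    have "(reversepath \<gamma> has_vector_derivative - 1 *\<^sub>R vector_derivative \<gamma> (at (1 - t))) (at t)"
      by (simp add: reversepath_def[abs_def] o_def)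
    then have "vector_derivative (reversepath \<gamma>) (at t) = (- 1) *\<^sub>R vector_derivative \<gamma> (at (1 - t))"
      using vector_derivative_at by blast
    then show "speed (reversepath \<gamma>) t = speed \<gamma> (1 - t)"
      using sqrt_G_scale[OF inH tan[OF t'], of "-1"] t' by (simp add: reversepath_def)
  qed
  then show ?thesis
    unfolding curve_lengths_def using vp ends by (auto intro!: exI[of _ "reversepath \<gamma>"])
qed

lemma dist_symmetric: "d x y = d y x"
proof -
  have "curve_lengths H G x y = curve_lengths H G y x" using curve_lengths_reverse by blast
  then show ?thesis by (simp add: riemannian_dist_def)
qed

lemma curve_lengths_join:
  assumes "L1 \<in> curve_lengths H G x y" "L2 \<in> curve_lengths H G y z"
  shows "L1 + L2 \<in> curve_lengths H G x z"
proof -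
  obtain \<gamma> S where vp: "valid_path \<gamma>" "path_image \<gamma> \<subseteq> H" and ends: "pathstart \<gamma> = x" "pathfinish \<gamma> = y"
    and int: "(speed \<gamma> has_integral L1) {0..1}" and S: "finite S" "0 \<in> S" "1 \<in> S"
    and der: "\<And>t. t \<in> {0..1} - S \<Longrightarrow> (\<gamma> has_vector_derivative vector_derivative \<gamma> (at t)) (at t)"
    and tan: "\<And>t. t \<in> {0..1} - S \<Longrightarrow> vector_derivative \<gamma> (at t) \<in> tangent_space H (\<gamma> t)"
    and inH: "\<And>t. t \<in> {0..1} \<Longrightarrow> \<gamma> t \<in> H" and cont: "continuous_on {0..1} \<gamma>"
    by (rule curve_lengthsE[OF assms(1)]) (rule that)
  obtain \<beta> R where vp2: "valid_path \<beta>" "path_image \<beta> \<subseteq> H" and ends2: "pathstart \<beta> = y" "pathfinish \<beta> = z"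
    and int2: "(speed \<beta> has_integral L2) {0..1}" and R: "finite R" "0 \<in> R" "1 \<in> R"
    and der2: "\<And>t. t \<in> {0..1} - R \<Longrightarrow> (\<beta> has_vector_derivative vector_derivative \<beta> (at t)) (at t)"
    and tan2: "\<And>t. t \<in> {0..1} - R \<Longrightarrow> vector_derivative \<beta> (at t) \<in> tangent_space H (\<beta> t)"
    and inH2: "\<And>t. t \<in> {0..1} \<Longrightarrow> \<beta> t \<in> H" and cont2: "continuous_on {0..1} \<beta>"
    by (rule curve_lengthsE[OF assms(2)]) (rule that)
  let ?\<alpha> = "\<gamma> +++ \<beta>"
  have "((\<lambda>t. 2 * speed \<gamma> (2 * t)) has_integral L1) {0..1/2}"
    using has_integral_mult_right[OF has_integral_affinity01[OF int, of 2 0], of 2]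
    by (simp add: image_affinity_atLeastAtMost_div[of 2 0 0 1, simplified])
  then have 1: "(speed ?\<alpha> has_integral L1) {0..1/2}"
  proof (rule has_integral_spike_finite[rotated 2])
    show "finite ((\<lambda>s. s / 2) ` S)" using S by simp
    fix t :: real assume t: "t \<in> {0..1/2} - (\<lambda>s. s / 2) ` S"
    have "2 * t \<notin> S"
    proof
      assume "2 * t \<in> S"
      then have "2 * t / 2 \<in> (\<lambda>s. s / 2) ` S" by blast
      then show False using t by simp
    qed
    then have t': "2 * t \<in> {0..1} - S" using t by auto
    then have t2: "t < 1/2" using S t by (cases "t = 1/2") auto
    have "((\<lambda>t. 2 * t) has_vector_derivative 2) (at t)" by (auto intro!: derivative_eq_intros)
    from vector_diff_chain_at[OF this der[OF t']]
    have "((\<lambda>t. \<gamma> (2 * t)) has_vector_derivative 2 *\<^sub>R vector_derivative \<gamma> (at (2 * t))) (at t)"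
      by (simp add: o_def)
    then have "(?\<alpha> has_vector_derivative 2 *\<^sub>R vector_derivative \<gamma> (at (2 * t))) (at t)"
      by (rule has_vector_derivative_transform_within_open[where S = "{..<1/2}"])
        (use t2 in \<open>auto simp: joinpaths_def\<close>)
    then have "vector_derivative ?\<alpha> (at t) = 2 *\<^sub>R vector_derivative \<gamma> (at (2 * t))"
      using vector_derivative_at by blast
    then show "speed ?\<alpha> t = 2 * speed \<gamma> (2 * t)"
      using sqrt_G_scale[OF inH tan[OF t'], of 2] t' t2 by (simp add: joinpaths_def)
  qed
  have "((\<lambda>t. 2 * speed \<beta> (2 * t - 1)) has_integral L2) {1/2..1}"
    using has_integral_mult_right[OF has_integral_affinity01[OF int2, of 2 "-1"], of 2]
    by (simp add: image_affinity_atLeastAtMost_div[of 2 "1/2" 0 1, simplified])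
  then have 2: "(speed ?\<alpha> has_integral L2) {1/2..1}"
  proof (rule has_integral_spike_finite[rotated 2])
    show "finite ((\<lambda>s. (s + 1) / 2) ` R)" using R by simp
    fix t :: real assume t: "t \<in> {1/2..1} - (\<lambda>s. (s + 1) / 2) ` R"
    have "2 * t - 1 \<notin> R"
    proof
      assume "2 * t - 1 \<in> R"
      then have "(2 * t - 1 + 1) / 2 \<in> (\<lambda>s. (s + 1) / 2) ` R" by blast
      then show False using t by simp
    qed
    then have t': "2 * t - 1 \<in> {0..1} - R" using t by auto
    then have t2: "t > 1/2" using R t by (cases "t = 1/2") auto
    have "((\<lambda>t. 2 * t - 1) has_vector_derivative 2) (at t)" by (auto intro!: derivative_eq_intros)
    from vector_diff_chain_at[OF this der2[OF t']]
    have "((\<lambda>t. \<beta> (2 * t - 1)) has_vector_derivative 2 *\<^sub>R vector_derivative \<beta> (at (2 * t - 1))) (at t)"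
      by (simp add: o_def)
    then have "(?\<alpha> has_vector_derivative 2 *\<^sub>R vector_derivative \<beta> (at (2 * t - 1))) (at t)"
      by (rule has_vector_derivative_transform_within_open[where S = "{1/2<..}"])
        (use t2 in \<open>auto simp: joinpaths_def\<close>)
    then have "vector_derivative ?\<alpha> (at t) = 2 *\<^sub>R vector_derivative \<beta> (at (2 * t - 1))"
      using vector_derivative_at by blast
    then show "speed ?\<alpha> t = 2 * speed \<beta> (2 * t - 1)"
      using sqrt_G_scale[OF inH2 tan2[OF t'], of 2] t' t2 by (simp add: joinpaths_def)
  qed
  have "(speed ?\<alpha> has_integral L1 + L2) {0..1}"
    by (rule has_integral_combine[OF _ _ 1 2]) auto
  moreover have "path_image ?\<alpha> \<subseteq> H" using path_image_join_subset vp(2) vp2(2) by blast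
  ultimately show ?thesis
    unfolding curve_lengths_def using vp vp2 ends ends2 valid_path_join[of \<gamma> \<beta>]
    by (auto intro!: exI[of _ ?\<alpha>])
qed

lemma dist_triangle_inequality:
  assumes "x \<in> H" "y \<in> H" "z \<in> H"
  shows "d x z \<le> d x y + d y z"
proof -
  have "d x z - L1 \<le> L2" if "L1 \<in> curve_lengths H G x y" "L2 \<in> curve_lengths H G y z" for L1 L2
    using dist_le_length[OF curve_lengths_join[OF that]] by simp
  then have "d x z - L1 \<le> d y z" if "L1 \<in> curve_lengths H G x y" for L1
    using that cInf_greatest[OF curve_lengths_nonempty[OF assms(2,3)], of "d x z - L1"]
      curve_lengths_nonempty[OF assms(2,3)] unfolding riemannian_dist_def[of _ _ y z] by auto
  then have "d x z - d y z \<le> L1" if "L1 \<in> curve_lengths H G x y" for L1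
    using that by force
  then have "d x z - d y z \<le> d x y"
    using cInf_greatest[OF curve_lengths_nonempty[OF assms(1,2)], of "d x z - d y z"]
      curve_lengths_nonempty[OF assms(1,2)] unfolding riemannian_dist_def[of _ _ x y] by auto
  then show ?thesis by simp
qed

lemma dist_refl: assumes "x \<in> H" shows "d x x = 0"
proof -
  have "d x x \<le> \<eta>" if "\<eta> > 0" for \<eta>
    using dist_small[OF assms that] assms by auto
  then have "d x x \<le> 0" by (rule field_le_epsilon[of _ 0, simplified])
  then show ?thesis using dist_nonneg[of x x] by simp
qed

text \<open>The unit tangent vectors over a small compact ball form a compact set, on which the quadratic
  form has a positive minimum.\<close>

lemma metric_ge_euclidean_locally:
  assumes "x \<in> H" "cball x \<delta> \<subseteq> U"
  obtains m where "m > 0" "\<And>z v. z \<in> H \<Longrightarrow> z \<in> cball x \<delta> \<Longrightarrow> v \<in> tangent_space H z \<Longrightarrow>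
    m * norm v \<le> sqrt (G z v v)"
proof -
  define K where "K = {s \<in> cball x \<delta> \<times> sphere 0 1. F (fst s) = 1 \<and> D F (fst s) (snd s) = 0}"
  have K: "fst s \<in> H" "snd s \<in> tangent_space H (fst s)" "norm (snd s) = 1" if "s \<in> K" for s
  proof -
    show "fst s \<in> H" using that F_eq_1_iff assms(2) unfolding K_def by auto
    then show "snd s \<in> tangent_space H (fst s)" using that unfolding K_def by (simp add: tangent_space_eq_kernel)
    show "norm (snd s) = 1" using that unfolding K_def by auto
  qed
  let ?B = "cball x \<delta> \<times> sphere (0::'a) 1"
  have lim: "(fst \<longlongrightarrow> fst s) (at s within T)" "(snd \<longlongrightarrow> snd s) (at s within T)" for s :: "'a \<times> 'a" and T
    by (auto intro: tendsto_fst tendsto_snd tendsto_ident_at)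
  have "continuous_on ?B (\<lambda>s. F (fst s))" "continuous_on ?B (\<lambda>s. D F (fst s) (snd s))"
    unfolding continuous_on_def
    by (intro ballI tendsto_F tendsto_D_F lim; use assms(2) in auto)+
  then have cl: "closed (?B \<inter> (\<lambda>s. F (fst s)) -` {1})" "closed (?B \<inter> (\<lambda>s. D F (fst s) (snd s)) -` {0})"
    by (simp_all add: continuous_closed_preimage closed_Times)
  have "compact ?B" by (intro compact_Times compact_cball compact_sphere)
  moreover have "K = ?B \<inter> ((?B \<inter> (\<lambda>s. F (fst s)) -` {1}) \<inter> (?B \<inter> (\<lambda>s. D F (fst s) (snd s)) -` {0}))"
    unfolding K_def by auto
  ultimately have "compact K"
    using compact_Int_closed closed_Int[OF cl] by simp
  moreover have "continuous_on K (\<lambda>s. G (fst s) (snd s) (snd s))"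
    unfolding continuous_on_def
    by (intro ballI G_tendsto lim K) (auto simp: eventually_at_filter K intro!: always_eventually)
  ultimately have "\<exists>m>0. \<forall>s\<in>K. m \<le> G (fst s) (snd s) (snd s)"
  proof (cases "K = {}")
    case False
    assume "compact K" "continuous_on K (\<lambda>s. G (fst s) (snd s) (snd s))"
    from continuous_attains_inf[OF this(1) False this(2)]
    obtain s where "s \<in> K" "\<forall>t\<in>K. G (fst s) (snd s) (snd s) \<le> G (fst t) (snd t) (snd t)" by blast
    moreover have "G (fst s) (snd s) (snd s) > 0"
      using G_pos K[OF \<open>s \<in> K\<close>] by force
    ultimately show ?thesis by blast
  qed (auto intro: exI[of _ 1])
  then obtain m where m: "m > 0" "\<And>s. s \<in> K \<Longrightarrow> m \<le> G (fst s) (snd s) (snd s)" by blast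
  show thesis
  proof (rule that)
    show "sqrt m > 0" using m by simp
    fix z v assume z: "z \<in> H" "z \<in> cball x \<delta>" and v: "v \<in> tangent_space H z"
    show "sqrt m * norm v \<le> sqrt (G z v v)"
    proof (cases "v = 0")
      case True then show ?thesis using G_zero z by simp
    next
      case False
      define w where "w = (1 / norm v) *\<^sub>R v"
      have w: "w \<in> tangent_space H z" "norm w = 1"
        using v z False linear_D_F[OF H_subset_U] by (auto simp: w_def tangent_space_eq_kernel linear_cmul)
      then have "(z, w) \<in> K" unfolding K_def using z by (simp add: F_eq_1 tangent_space_eq_kernel)
      then have "sqrt m \<le> sqrt (G z w w)" using m(2) by force
      then have "sqrt m * norm v \<le> sqrt (G z w w) * norm v" by (rule mult_right_mono) simp
      also have "\<dots> = sqrt (G z v v)"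
        using sqrt_G_scale[OF z(1) w(1), of "norm v"] False by (simp add: w_def)
      finally show ?thesis .
    qed
  qed
qed

text \<open>A continuously differentiable bump function around \<open>x\<close> that vanishes at
  \<open>y\<close> is Lipschitz for the distance, because its differential is supported in a ball on which
  the metric dominates a multiple of the Euclidean one.\<close>

lemma dist_pos:
  assumes "x \<in> H" "y \<in> H" "x \<noteq> y"
  shows "d x y > 0"
proof -
  obtain \<delta>0 where \<delta>0: "\<delta>0 > 0" "cball x \<delta>0 \<subseteq> U"
    using open_contains_cball open_U H_subset_U[OF assms(1)] by blast
  define \<delta> where "\<delta> = min \<delta>0 (dist x y)"
  have \<delta>: "\<delta> > 0" "cball x \<delta> \<subseteq> U" "\<delta> \<le> dist x y" using \<delta>0 assms(3) by (auto simp: \<delta>_def)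
  obtain m where m: "m > 0" "\<And>z v. z \<in> H \<Longrightarrow> z \<in> cball x \<delta> \<Longrightarrow> v \<in> tangent_space H z \<Longrightarrow>
    m * norm v \<le> sqrt (G z v v)"
    using metric_ge_euclidean_locally[OF assms(1) \<delta>(2)] by blast
  define q where "q = (\<lambda>z. \<delta>\<^sup>2 - (z - x) \<bullet> (z - x))"
  define u where "u = (\<lambda>z. (max 0 (q z))\<^sup>2)"
  define u' where "u' = (\<lambda>z v. 2 * max 0 (q z) * (- 2 * ((z - x) \<bullet> v)))"
  have u': "(u has_derivative u' z) (at z)" for z
  proof -
    have q': "(q has_derivative (\<lambda>v. - 2 * ((z - x) \<bullet> v))) (at z)"
      unfolding q_def by (auto intro!: derivative_eq_intros simp: inner_commute)
    have "((\<lambda>s::real. (max 0 s)\<^sup>2) has_derivative (*) (2 * max 0 (q z))) (at (q z))"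
      using DERIV_max_0_square[of "q z"] by (simp add: has_field_derivative_def)
    from diff_chain_at[OF q' this] show ?thesis by (simp add: u_def u'_def o_def)
  qed
  have "\<bar>u' z v\<bar> \<le> (4 * \<delta>^3 / m) * sqrt (G z v v)" if z: "z \<in> H" and v: "v \<in> tangent_space H z" for z v
  proof (cases "z \<in> cball x \<delta>")
    case True
    then have n: "norm (z - x) \<le> \<delta>" by (simp add: dist_norm norm_minus_commute)
    have "\<bar>u' z v\<bar> = (4 * max 0 (q z)) * \<bar>(z - x) \<bullet> v\<bar>" by (simp add: u'_def abs_mult)
    also have "\<dots> \<le> (4 * \<delta>\<^sup>2) * (\<delta> * norm v)"
    proof (rule mult_mono)
      show "\<bar>(z - x) \<bullet> v\<bar> \<le> \<delta> * norm v"
        using Cauchy_Schwarz_ineq2[of "z - x" v] mult_right_mono[OF n norm_ge_zero[of v]] by linarith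
    qed (auto simp: q_def)
    also have "\<dots> = (4 * \<delta>^3 / m) * (m * norm v)"
      using m(1) by (simp add: power2_eq_square power3_eq_cube)
    also have "\<dots> \<le> (4 * \<delta>^3 / m) * sqrt (G z v v)"
      using m(1) \<delta>(1) by (intro mult_left_mono m(2)[OF z True v]) auto
    finally show ?thesis .
  next
    case False
    then have "\<delta> < norm (z - x)" by (simp add: dist_norm norm_minus_commute)
    then have "\<delta>\<^sup>2 \<le> (norm (z - x))\<^sup>2" using \<delta>(1) by (intro power_mono) auto
    then have "max 0 (q z) = 0" by (simp add: q_def power2_norm_eq_inner)
    then have "u' z v = 0" by (simp add: u'_def)
    then show ?thesis using m(1) \<delta>(1) G_nonneg[OF z v] by simp
  qed
  then have "\<bar>u y - u x\<bar> \<le> (4 * \<delta>^3 / m) * d x y"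
    using \<delta>(1) m(1) by (intro increment_le_dist[OF assms(1,2) _ u']) auto
  moreover have "u x = \<delta>^4" by (simp add: u_def q_def)
  moreover have "u y = 0"
  proof -
    have "\<delta>\<^sup>2 \<le> (norm (y - x))\<^sup>2" using \<delta> by (intro power_mono) (auto simp: dist_norm norm_minus_commute)
    then show ?thesis by (simp add: u_def q_def power2_norm_eq_inner)
  qed
  ultimately have "\<delta>^4 \<le> (4 * \<delta>^3 / m) * d x y" by simp
  then have "0 < (4 * \<delta>^3 / m) * d x y" using zero_less_power[OF \<delta>(1), of 4] by linarith
  then show ?thesis by (rule zero_less_mult_pos) (use m(1) \<delta>(1) in simp)
qed

lemma metric_space: "Metric_space H d"
proof
  show "d x y = 0 \<longleftrightarrow> x = y" if "x \<in> H" "y \<in> H" for x y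
    using dist_refl dist_pos that by force
qed (use dist_nonneg dist_symmetric dist_triangle_inequality in auto)

text \<open>A subsequence converges in the Euclidean topology, hence in the distance by
  \<open>dist_small\<close>, and a Cauchy sequence converges together with a subsequence.\<close>

lemma complete_if_Cauchy_in_compact:
  assumes "\<And>\<sigma>. Metric_space.MCauchy H d \<sigma> \<Longrightarrow> \<exists>K. compact K \<and> K \<subseteq> H \<and> range \<sigma> \<subseteq> K"
  shows "riemannian_complete H G"
proof -
  interpret M: Metric_space H d by (rule metric_space)
  have "\<exists>x. limitin M.mtopology \<sigma> x sequentially" if \<sigma>: "M.MCauchy \<sigma>" for \<sigma>
  proof -
    obtain K where K: "compact K" "K \<subseteq> H" "range \<sigma> \<subseteq> K" using assms[OF \<sigma>] by blast
    then obtain x r where x: "x \<in> K" "strict_mono r" "(\<sigma> \<circ> r) \<longlonglongrightarrow> x"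
      by (metis compact_def range_subsetD)
    have inH: "\<sigma> n \<in> H" for n using K by auto
    have "limitin M.mtopology (\<sigma> \<circ> r) x sequentially"
      unfolding M.limit_metric_sequentially
    proof (intro conjI allI impI)
      show "x \<in> H" using x K by auto
      fix \<eta> :: real assume "\<eta> > 0"
      then obtain \<delta> where \<delta>: "\<delta> > 0" "\<And>y. y \<in> H \<Longrightarrow> dist y x < \<delta> \<Longrightarrow> d x y \<le> \<eta> / 2"
        using dist_small[OF \<open>x \<in> H\<close>, of "\<eta> / 2"] by auto
      obtain N where "\<And>n. n \<ge> N \<Longrightarrow> dist ((\<sigma> \<circ> r) n) x < \<delta>"
        using x(3) \<delta>(1) unfolding lim_sequentially by blast
      then have "(\<sigma> \<circ> r) n \<in> H \<and> d ((\<sigma> \<circ> r) n) x < \<eta>" if "n \<ge> N" for n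
        using \<delta>(2)[of "(\<sigma> \<circ> r) n"] that inH \<open>\<eta> > 0\<close> dist_symmetric[of "(\<sigma> \<circ> r) n" x] by fastforce
      then show "\<exists>N. \<forall>n\<ge>N. (\<sigma> \<circ> r) n \<in> H \<and> d ((\<sigma> \<circ> r) n) x < \<eta>" by blast
    qed
    then show ?thesis using M.MCauchy_convergent_subsequence[OF \<sigma> x(2)] by blast
  qed
  then show ?thesis unfolding riemannian_complete_def M.mcomplete_def by blast
qed

end

section \<open>Concavity in the tangent section\<close>

lemma concave_on_le_tangent:
  fixes f :: "'a::euclidean_space \<Rightarrow> real"
  assumes "concave_on S f" "x \<in> S" "y \<in> S" and f': "(f has_derivative f') (at x)"
  shows "f y \<le> f x + f' (y - x)"
proof -
  define q where "q = (\<lambda>t::real. f (x + t *\<^sub>R (y - x)))"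
  have "((\<lambda>t::real. x + t *\<^sub>R (y - x)) has_vector_derivative (y - x)) (at 0)"
    by (auto intro!: derivative_eq_intros)
  from vector_derivative_diff_chain_within[OF this, of f f'] f'
  have "(q has_real_derivative f' (y - x)) (at 0)"
    by (simp add: q_def o_def has_derivative_at_withinI has_real_derivative_iff_has_vector_derivative)
  then have "((\<lambda>t. (q t - q 0) / t) \<longlongrightarrow> f' (y - x)) (at 0)"
    by (simp add: DERIV_def)
  then have "((\<lambda>t. (q t - q 0) / t) \<longlongrightarrow> f' (y - x)) (at_right 0)"
    by (rule filterlim_mono) (auto simp: at_le)
  moreover have "eventually (\<lambda>t::real. f y - f x \<le> (q t - q 0) / t) (at_right 0)"
    unfolding eventually_at_right_field
  proof (intro exI[of _ 1] conjI allI impI)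
    fix t :: real assume t: "0 < t" "t < 1"
    have "(1 - t) * f x + t * f y \<le> f ((1 - t) *\<^sub>R x + t *\<^sub>R y)"
      using concave_onD[OF assms(1), of t x y] t assms by simp
    also have "(1 - t) *\<^sub>R x + t *\<^sub>R y = x + t *\<^sub>R (y - x)" by (simp add: algebra_simps)
    finally have "(f y - f x) * t \<le> q t - q 0" by (simp add: q_def algebra_simps)
    then show "f y - f x \<le> (q t - q 0) / t" using t by (simp only: pos_le_divide_eq)
  qed simp
  ultimately have "f y - f x \<le> f' (y - x)"
    by (rule tendsto_lowerbound) simp
  then show ?thesis by simp
qed

lemma second_derivative_nonneg_at_minimum:
  fixes \<phi> :: "real \<Rightarrow> real"
  assumes e: "e > 0" and min: "\<And>t. \<bar>t\<bar> < e \<Longrightarrow> \<phi> 0 \<le> \<phi> t"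
    and \<phi>': "\<And>t. \<bar>t\<bar> < e \<Longrightarrow> (\<phi> has_real_derivative \<phi>' t) (at t)"
    and c: "(\<phi>' has_real_derivative c) (at 0)"
  shows "c \<ge> 0"
proof (rule ccontr)
  assume "\<not> c \<ge> 0"
  then obtain d where d: "d > 0" "\<And>h. 0 < h \<Longrightarrow> h < d \<Longrightarrow> \<phi>' (0 + h) < \<phi>' 0"
    using DERIV_neg_dec_right[OF c] by auto
  have "\<phi>' 0 = 0"
    by (rule DERIV_local_min[OF \<phi>' e]) (use e min in auto)
  define h where "h = min d e / 2"
  have h: "0 < h" "h < d" "h < e" using d e by (auto simp: h_def)
  obtain \<xi> where \<xi>: "0 < \<xi>" "\<xi> < h" "\<phi> h - \<phi> 0 = (h - 0) * \<phi>' \<xi>"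
    using MVT2[OF h(1), of \<phi> \<phi>'] \<phi>' h by auto
  have "\<phi>' \<xi> < 0" using d(2)[of \<xi>] \<xi> h \<open>\<phi>' 0 = 0\<close> by simp
  then have "\<phi> h < \<phi> 0" using \<xi>(3) h mult_pos_neg[of h "\<phi>' \<xi>"] by simp
  then show False using min[of h] h by simp
qed

text \<open>The exponent \<open>\<beta>\<close> stands for \<open>k / (k - \<epsilon>)\<close>. Convexity of
  the section is part of the meaning of \<^const>\<open>concave_on\<close>.\<close>

locale concave_section = radial_hypersurface H F
  for H :: "'a::euclidean_space set" and F +
  fixes p :: 'a and \<beta> :: real
  assumes p: "p \<in> H" and \<beta>: "\<beta> > 1"
    and connected: "connected H"
    and hyperbolic: "x \<in> H \<Longrightarrow> v \<in> tangent_space H x \<Longrightarrow> v \<noteq> 0 \<Longrightarrow> centroaffine_metric H x v v > 0"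
    and concave: "concave_on (U \<inter> {y. D F p y = 1}) (\<lambda>y. F y powr \<beta>)"
begin

abbreviation l :: "'a \<Rightarrow> real" where "l \<equiv> D F p"

abbreviation E :: "'a set" where "E \<equiv> U \<inter> {y. l y = 1}"

lemma linear_l: "linear l" by (rule linear_D_F[OF H_subset_U[OF p]])

lemmas l_simps = linear_add[OF linear_l] linear_diff[OF linear_l] linear_cmul[OF linear_l]

lemma l_p: "l p = 1" using Euler_identity[OF H_subset_U[OF p]] F_eq_1[OF p] by simp

lemma p_in_E: "p \<in> E" using H_subset_U p l_p by auto

lemma convex_E: "convex E" using concave by (rule concave_on_imp_convex)

lemma scale_in_E: assumes "z \<in> U" "l z > 0" shows "(1 / l z) *\<^sub>R z \<in> E"
  using U_scale(1)[OF assms(1), of "1 / l z"] assms by (simp add: l_simps)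

lemma F_powr_has_derivative:
  assumes "z \<in> U"
  shows "((\<lambda>y. F y powr \<beta>) has_derivative (\<lambda>v. \<beta> * F z powr (\<beta> - 1) * D F z v)) (at z)"
proof -
  have "((\<lambda>s. s powr \<beta>) has_derivative (*) (\<beta> * F z powr (\<beta> - 1))) (at (F z))"
    using has_real_derivative_powr[OF F_pos[OF assms], of \<beta>] by (simp add: has_field_derivative_def)
  from diff_chain_at[OF F_has_derivative[OF assms] this] show ?thesis by (simp add: o_def)
qed

lemma E_tangent_bound:
  assumes "x \<in> E" "y \<in> E"
  shows "F y powr \<beta> \<le> F x powr \<beta> + \<beta> * F x powr (\<beta> - 1) * D F x (y - x)"
  using concave_on_le_tangent[OF concave assms F_powr_has_derivative] assms by simp

lemma F_powr_le_1: assumes "y \<in> E" shows "F y powr \<beta> \<le> 1"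
  using E_tangent_bound[OF p_in_E assms] assms F_eq_1[OF p] by (simp add: l_simps l_p)

lemma F_le_1: assumes "y \<in> E" shows "F y \<le> 1"
proof (rule ccontr)
  assume "\<not> F y \<le> 1"
  then have "F y powr \<beta> > 1" using gr_one_powr[of "F y" \<beta>] \<beta> by simp
  then show False using F_powr_le_1[OF assms] by simp
qed

text \<open>On \<open>H\<close> the values of \<open>l\<close> cannot lie strictly between \<open>0\<close>
  and \<open>1\<close>: rescaling a point \<open>x\<close> with \<open>l x > 0\<close> to the section gives
  the value \<open>1 / l x \<le> 1\<close> of \<open>F\<close>. The connected set \<open>H\<close> stays on
  the side of \<open>p\<close>.\<close>

lemma l_ge_1: assumes "x \<in> H" shows "l x \<ge> 1"
proof -
  have gap: "l x \<ge> 1" if "x \<in> H" "l x > 0" for x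
    using F_le_1[OF scale_in_E[OF H_subset_U[OF that(1)] that(2)]] that
      U_scale(2)[OF H_subset_U[OF that(1)], of "1 / l x"] by (simp add: F_eq_1)
  have cont: "continuous_on UNIV l" by (rule linear_continuous_on[OF linear_conv_bounded_linear[THEN iffD1, OF linear_l]])
  have "{z. 0 < l z} \<inter> H = {} \<or> {z. l z < 1} \<inter> H = {}"
  proof (rule connectedD[OF connected])
    show "open {z. 0 < l z}" "open {z. l z < 1}"
      by (auto intro!: open_Collect_less cont continuous_on_const)
  qed (use gap in force)+
  then show ?thesis using p l_p assms by force
qed

lemma F_le_l: assumes "z \<in> U" shows "F z \<le> l z"
proof -
  have "1 \<le> l (proj z)" using l_ge_1 proj_in_H assms by blast
  then show ?thesis using F_pos[OF assms] by (simp add: proj_def l_simps)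
qed

lemma l_pos: "z \<in> U \<Longrightarrow> l z > 0"
  using F_le_l F_pos by force

lemma convex_U: "convex U"
  unfolding convex_alt
proof (intro ballI allI impI)
  fix a b and t :: real assume a: "a \<in> U" and b: "b \<in> U" and t: "0 \<le> t \<and> t \<le> 1"
  define L where "L = (1 - t) * l a + t * l b"
  have L: "L > 0"
  proof (cases "t = 0")
    case False
    then have "t * l b > 0" using t l_pos[OF b] by simp
    moreover have "(1 - t) * l a \<ge> 0" using t l_pos[OF a] by simp
    ultimately show ?thesis by (simp add: L_def)
  qed (simp add: L_def l_pos[OF a])
  have "((1 - t) * l a / L) *\<^sub>R ((1 / l a) *\<^sub>R a) + (t * l b / L) *\<^sub>R ((1 / l b) *\<^sub>R b) \<in> E"
    by (rule convexD[OF convex_E scale_in_E[OF a l_pos[OF a]] scale_in_E[OF b l_pos[OF b]]])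
      (use t L l_pos[OF a] l_pos[OF b] in \<open>auto simp: L_def add_divide_distrib[symmetric]\<close>)
  then have "((1 - t) / L) *\<^sub>R a + (t / L) *\<^sub>R b \<in> U"
    using l_pos[OF a] l_pos[OF b] by simp
  from U_scale(1)[OF this L] show "(1 - t) *\<^sub>R a + t *\<^sub>R b \<in> U"
    using L by (simp add: scaleR_add_right)
qed

sublocale centroaffine: riemannian_hypersurface H F "centroaffine_metric H"
  by unfold_locales (use convex_U metric_homogeneous hyperbolic tendsto_metric in auto)

sublocale euclidean: riemannian_hypersurface H F "\<lambda>x u w. u \<bullet> w"
  by unfold_locales (auto simp: convex_U power2_eq_square intro: tendsto_inner)

section \<open>A lower bound for the centroaffine metric\<close>

text \<open>The tangent bound for \<open>F powr \<beta>\<close> at the section point of \<open>x\<close>,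
  evaluated at the section point of \<open>z\<close> and multiplied by \<open>l z\<close>. The right-hand
  side is linear in \<open>z\<close>, and both sides agree at \<open>z = x\<close>.\<close>

lemma supporting_bound:
  assumes "x \<in> H" "z \<in> H"
  shows "l z powr (1 - \<beta>) \<le> \<beta> * l x powr (1 - \<beta>) * D F x z + (1 - \<beta>) * l x powr (- \<beta>) * l z"
proof -
  define L M where "L = l x" and "M = l z"
  have LM: "L > 0" "M > 0" using l_pos H_subset_U assms by (auto simp: L_def M_def)
  have U: "x \<in> U" "z \<in> U" using assms H_subset_U by auto
  define y0 y where "y0 = (1 / L) *\<^sub>R x" and "y = (1 / M) *\<^sub>R z"
  have E: "y0 \<in> E" "y \<in> E" using scale_in_E U LM by (auto simp: y0_def y_def L_def M_def)
  have Fy: "F y0 = 1 / L" "F y = 1 / M"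
    using U_scale(2) U LM F_eq_1 assms by (auto simp: y0_def y_def)
  have "proj y0 = x" using LM Fy by (simp add: proj_def) (simp add: y0_def)
  then have DF: "D F y0 = D F x" using D_F_proj[of y0] E by simp
  have "D F x (y - y0) = D F x z / M - 1 / L"
    using Euler_identity[OF U(1)] F_eq_1[OF assms(1)]
    by (simp add: y0_def y_def linear_diff[OF linear_D_F[OF U(1)]] linear_cmul[OF linear_D_F[OF U(1)]])
  then have *: "(1 / M) powr \<beta> \<le> (1 / L) powr \<beta> + \<beta> * (1 / L) powr (\<beta> - 1) * (D F x z / M - 1 / L)"
    using E_tangent_bound[OF E] by (simp add: Fy DF)
  have inv: "(1 / s) powr c = s powr (- c)" if "s > 0" for s c :: real
    using that by (simp add: powr_divide powr_minus_divide)
  have pw: "(1 / M) powr \<beta> = M powr (- \<beta>)" "(1 / L) powr \<beta> = L powr (- \<beta>)"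
    "(1 / L) powr (\<beta> - 1) = L powr (1 - \<beta>)"
    by (simp_all only: inv[OF LM(1)] inv[OF LM(2)] minus_diff_eq)
  have "M * M powr (- \<beta>) \<le> M * (L powr (- \<beta>) + \<beta> * L powr (1 - \<beta>) * (D F x z / M - 1 / L))"
    using * LM unfolding pw by (intro mult_left_mono) auto
  also have "\<dots> = M * L powr (- \<beta>) + \<beta> * L powr (1 - \<beta>) * D F x z - \<beta> * (L powr (1 - \<beta>) / L) * M"
    using LM by (simp add: algebra_simps)
  also have "L powr (1 - \<beta>) / L = L powr (- \<beta>)"
    using LM powr_diff[of L "1 - \<beta>" 1] by simp
  also have "M * M powr (- \<beta>) = M powr (1 - \<beta>)"
    using LM powr_add[of M 1 "- \<beta>"] by simp
  finally show ?thesis by (simp add: L_def M_def algebra_simps)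
qed

text \<open>Along a curve in \<open>H\<close> with velocity \<open>v\<close> the difference of the two sides
  of \<open>supporting_bound\<close> has a minimum at \<open>x\<close>, so its second derivative is
  nonnegative there. The terms with \<open>l\<close> of the acceleration cancel, its \<open>D F x\<close> is
  the metric, and the second derivative of the power leaves \<open>(l v)\<^sup>2\<close> with a coefficient
  proportional to \<open>\<beta> - 1\<close>.\<close>

lemma metric_lower_bound:
  assumes "x \<in> H" "v \<in> tangent_space H x"
  shows "(\<beta> - 1) * (l v / l x)\<^sup>2 \<le> centroaffine_metric H x v v"
proof -
  obtain \<gamma> \<gamma>' a e where e: "e > 0" and inH: "\<And>t. \<bar>t\<bar> < e \<Longrightarrow> \<gamma> t \<in> H"
    and \<gamma>': "\<And>t. \<bar>t\<bar> < e \<Longrightarrow> (\<gamma> has_vector_derivative \<gamma>' t) (at t)"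
    and a: "(\<gamma>' has_vector_derivative a) (at (0::real))" and 0: "\<gamma> 0 = x" "\<gamma>' 0 = v"
    by (rule tangent_vector_accelerated_curve[OF assms]) (rule that)
  define g where "g = centroaffine_metric H x v v"
  have acc: "D F x a = g" using metric_eq_acceleration(2)[OF e inH \<gamma>' a] by (simp add: 0 g_def)
  define L where "L = l x"
  have L: "L > 0" using l_pos H_subset_U assms by (auto simp: L_def)
  have lpos: "l (\<gamma> t) > 0" if "\<bar>t\<bar> < e" for t using l_pos H_subset_U inH that by blast
  have lin: "linear (D F x)" using linear_D_F H_subset_U assms by blast
  have l1: "((\<lambda>t. A (\<gamma> t)) has_real_derivative A (\<gamma>' t)) (at t)"
    if "\<bar>t\<bar> < e" "linear A" for A :: "'a \<Rightarrow> real" and t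
    using bounded_linear.has_vector_derivative[OF linear_conv_bounded_linear[THEN iffD1, OF that(2)] \<gamma>'[OF that(1)]]
    by (simp add: has_real_derivative_iff_has_vector_derivative)
  have l2: "((\<lambda>t. A (\<gamma>' t)) has_real_derivative A a) (at 0)"
    if "linear A" for A :: "'a \<Rightarrow> real"
    using bounded_linear.has_vector_derivative[OF linear_conv_bounded_linear[THEN iffD1, OF that] a]
    by (simp add: has_real_derivative_iff_has_vector_derivative)
  define c1 c2 where "c1 = \<beta> * L powr (1 - \<beta>)" and "c2 = (1 - \<beta>) * L powr (- \<beta>)"
  define \<phi> where "\<phi> = (\<lambda>t. c1 * D F x (\<gamma> t) + c2 * l (\<gamma> t) - l (\<gamma> t) powr (1 - \<beta>))"
  define \<phi>' where "\<phi>' = (\<lambda>t. c1 * D F x (\<gamma>' t) + c2 * l (\<gamma>' t) -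
      (1 - \<beta>) * l (\<gamma> t) powr (- \<beta>) * l (\<gamma>' t))"
  have d1: "(\<phi> has_real_derivative \<phi>' t) (at t)" if "\<bar>t\<bar> < e" for t
  proof -
    have "((\<lambda>t. l (\<gamma> t) powr (1 - \<beta>)) has_real_derivative (1 - \<beta>) * l (\<gamma> t) powr (1 - \<beta> - 1) * l (\<gamma>' t)) (at t)"
      by (rule DERIV_chain2[OF has_real_derivative_powr[OF lpos[OF that]] l1[OF that linear_l]])
    then have pw: "((\<lambda>t. l (\<gamma> t) powr (1 - \<beta>)) has_real_derivative (1 - \<beta>) * l (\<gamma> t) powr (- \<beta>) * l (\<gamma>' t)) (at t)"
      by simp
    show ?thesis unfolding \<phi>_def \<phi>'_def
      by (intro DERIV_diff DERIV_add DERIV_cmult l1[OF that] lin linear_l pw)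
  qed
  have d2: "(\<phi>' has_real_derivative c1 * g + c2 * l a - ((1 - \<beta>) * L powr (- \<beta>) * l a
      + (1 - \<beta>) * (- \<beta> * L powr (- \<beta> - 1) * l v) * l v)) (at 0)"
  proof -
    have "((\<lambda>t. l (\<gamma> t) powr (- \<beta>)) has_real_derivative - \<beta> * l (\<gamma> 0) powr (- \<beta> - 1) * l (\<gamma>' 0)) (at 0)"
      by (rule DERIV_chain2[OF has_real_derivative_powr[OF lpos] l1[OF _ linear_l]]) (use e in auto)
    then have pw: "((\<lambda>t. l (\<gamma> t) powr (- \<beta>)) has_real_derivative - \<beta> * L powr (- \<beta> - 1) * l v) (at 0)"
      by (simp add: 0 L_def)
    have "((\<lambda>t. ((1 - \<beta>) * l (\<gamma> t) powr (- \<beta>)) * l (\<gamma>' t)) has_real_derivative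
        ((1 - \<beta>) * (- \<beta> * L powr (- \<beta> - 1) * l v)) * l (\<gamma>' 0) + l a * ((1 - \<beta>) * l (\<gamma> 0) powr (- \<beta>))) (at 0)"
      by (rule DERIV_mult[OF DERIV_cmult[OF pw] l2[OF linear_l]])
    then have pw2: "((\<lambda>t. (1 - \<beta>) * l (\<gamma> t) powr (- \<beta>) * l (\<gamma>' t)) has_real_derivative
        (1 - \<beta>) * L powr (- \<beta>) * l a + (1 - \<beta>) * (- \<beta> * L powr (- \<beta> - 1) * l v) * l v) (at 0)"
      by (simp add: 0 L_def algebra_simps)
    have "((\<lambda>t. c1 * D F x (\<gamma>' t) + c2 * l (\<gamma>' t)) has_real_derivative c1 * D F x a + c2 * l a) (at 0)"
      by (intro DERIV_add DERIV_cmult l2 lin linear_l)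
    from DERIV_diff[OF this pw2] show ?thesis unfolding \<phi>'_def acc .
  qed
  have "\<phi> 0 = 0"
  proof -
    have "L powr (- \<beta>) * L = L powr (1 - \<beta>)" using L powr_add[of L "- \<beta>" 1] by simp
    moreover have "D F x x = 1" using Euler_identity F_eq_1 H_subset_U assms by simp
    ultimately show ?thesis by (simp add: \<phi>_def c1_def c2_def 0 L_def[symmetric] algebra_simps)
  qed
  moreover have "\<phi> t \<ge> 0" if "\<bar>t\<bar> < e" for t
    using supporting_bound[OF assms(1) inH[OF that]] by (simp add: \<phi>_def c1_def c2_def L_def)
  ultimately have "c1 * g + c2 * l a - ((1 - \<beta>) * L powr (- \<beta>) * l a
      + (1 - \<beta>) * (- \<beta> * L powr (- \<beta> - 1) * l v) * l v) \<ge> 0"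
    by (intro second_derivative_nonneg_at_minimum[OF e _ d1 d2]) auto
  then have "\<beta> * L powr (1 - \<beta>) * g \<ge> (\<beta> - 1) * \<beta> * L powr (- \<beta> - 1) * (l v)\<^sup>2"
    by (simp add: c1_def c2_def power2_eq_square algebra_simps)
  also have "L powr (- \<beta> - 1) = L powr (1 - \<beta>) / L\<^sup>2"
  proof -
    have "- \<beta> - 1 = (1 - \<beta>) - 2" by simp
    then show ?thesis using L powr_diff[of L "1 - \<beta>" 2] by (simp only: powr_numeral)
  qed
  finally have "(\<beta> * L powr (1 - \<beta>)) * ((\<beta> - 1) * (l v / L)\<^sup>2) \<le> (\<beta> * L powr (1 - \<beta>)) * g"
    by (simp add: power_divide ac_simps)
  moreover have "\<beta> * L powr (1 - \<beta>) > 0" using \<beta> L by simp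
  ultimately show ?thesis unfolding g_def L_def by (simp only: mult_le_cancel_left_pos)
qed

section \<open>The tangent section is bounded\<close>

lemma F_powr_linepath:
  assumes "x \<in> E" "y \<in> E" "t \<in> {0..1}"
  shows "linepath x y t \<in> E" "(1 - t) * F x powr \<beta> + t * F y powr \<beta> \<le> F (linepath x y t) powr \<beta>"
  using convexD_alt[OF convex_E assms(1,2), of t] concave_onD[OF concave, of t x y] assms
  by (auto simp: linepath_def)

lemma F_mono_powr: "y \<in> E \<Longrightarrow> z \<in> E \<Longrightarrow> F y powr \<beta> \<le> F z powr \<beta> \<Longrightarrow> F y \<le> F z"
  using powr_less_mono2[of \<beta> "F z" "F y"] F_pos[of z] \<beta> by force

text \<open>If \<open>F\<close> equals one at a second point of the section, concavity makes it equal to one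
  on the whole segment, which then lies in \<open>H\<close>. A straight line in \<open>H\<close> has no
  acceleration, against the definiteness of the metric.\<close>

lemma unique_maximum:
  assumes "y \<in> E" "F y = 1"
  shows "y = p"
proof (rule ccontr)
  assume "y \<noteq> p"
  define w where "w = y - p"
  define m where "m = p + (1/2) *\<^sub>R w"
  define \<gamma> where "\<gamma> = (\<lambda>t. m + t *\<^sub>R w)"
  have inH: "\<gamma> t \<in> H" if "\<bar>t\<bar> < 1/2" for t
  proof -
    have "\<gamma> t = linepath p y (t + 1/2)"
      by (simp add: \<gamma>_def m_def w_def linepath_def algebra_simps flip: scaleR_add_left)
    moreover have "t + 1/2 \<in> {0..1}" using that by (auto simp: abs_less_iff)
    ultimately have \<gamma>E: "\<gamma> t \<in> E" and "1 \<le> F (\<gamma> t) powr \<beta>"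
      using F_powr_linepath[OF p_in_E assms(1), of "t + 1/2"] assms(2) F_eq_1[OF p] by auto
    then have "F p \<le> F (\<gamma> t)"
      using F_eq_1[OF p] by (intro F_mono_powr[OF p_in_E]) auto
    then have "F (\<gamma> t) = 1" using F_le_1[OF \<gamma>E] F_eq_1[OF p] by simp
    then show ?thesis using F_eq_1_iff \<gamma>E by blast
  qed
  have "(\<gamma> has_vector_derivative w) (at t)" for t
    unfolding \<gamma>_def by (auto intro!: derivative_eq_intros)
  from metric_eq_acceleration[of "1/2" \<gamma> "\<lambda>_. w", OF _ inH this has_vector_derivative_const]
  have "w \<in> tangent_space H (\<gamma> 0)" "D F (\<gamma> 0) 0 = centroaffine_metric H (\<gamma> 0) w w" by auto
  moreover have "\<gamma> 0 \<in> H" using inH by simp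
  moreover have "w \<noteq> 0" using \<open>y \<noteq> p\<close> by (simp add: w_def)
  ultimately show False
    using hyperbolic[of "\<gamma> 0" w] linear_0[OF linear_D_F[OF H_subset_U]] by simp
qed

text \<open>On a small sphere around \<open>p\<close> in the section the function is at most \<open>1 -
  \<eta>\<close>. Concavity continues this decrease linearly along rays from \<open>p\<close>, and
  positivity stops it at distance \<open>\<delta> / \<eta>\<close>.\<close>

lemma bounded_E: "bounded E"
proof -
  obtain \<delta> where \<delta>: "\<delta> > 0" "cball p \<delta> \<subseteq> U"
    using open_contains_cball open_U H_subset_U[OF p] by blast
  have contF: "continuous_on U (\<lambda>y. F y powr \<beta>)"
    by (intro continuous_on_powr continuous_F continuous_on_const) (use F_pos in force)
  have cont: "continuous_on UNIV l" by (rule linear_continuous_on[OF linear_conv_bounded_linear[THEN iffD1, OF linear_l]])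
  define K where "K = sphere p \<delta> \<inter> {y. l y = 1}"
  have "closed {y. l y = 1}" by (intro closed_Collect_eq cont continuous_on_const)
  then have K: "compact K" unfolding K_def by (intro compact_Int_closed compact_sphere)
  have KE: "K \<subseteq> E" using \<delta> unfolding K_def by auto
  have "\<exists>\<eta>>0. \<forall>y\<in>K. F y powr \<beta> \<le> 1 - \<eta>"
  proof (cases "K = {}")
    case False
    obtain q where q: "q \<in> K" "\<And>y. y \<in> K \<Longrightarrow> F y powr \<beta> \<le> F q powr \<beta>"
      using continuous_attains_sup[OF K False continuous_on_subset[OF contF]] KE by blast
    have "F q \<noteq> 1" using unique_maximum[of q] KE q(1) \<delta>(1) unfolding K_def by auto
    then have "F q < 1" using F_le_1[of q] KE q(1) by force
    then have "F q powr \<beta> < 1"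
      using powr_less_mono2[of \<beta> "F q" 1] F_pos[of q] KE q(1) \<beta> by force
    then show ?thesis using q(2) by (intro exI[of _ "1 - F q powr \<beta>"]) auto
  qed (auto intro: exI[of _ 1])
  then obtain \<eta> where \<eta>: "\<eta> > 0" "\<And>y. y \<in> K \<Longrightarrow> F y powr \<beta> \<le> 1 - \<eta>" by blast
  have "norm (y - p) \<le> max \<delta> (\<delta> / \<eta>)" if y: "y \<in> E" for y
  proof (cases "norm (y - p) \<le> \<delta>")
    case False
    define \<theta> where "\<theta> = \<delta> / norm (y - p)"
    have pos: "norm (y - p) > 0" using False \<delta>(1) by linarith
    have \<theta>: "0 < \<theta>" "\<theta> < 1" using False \<delta>(1) pos by (auto simp: \<theta>_def)
    have "linepath p y \<theta> - p = \<theta> *\<^sub>R (y - p)" by (simp add: linepath_def algebra_simps)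
    then have "dist p (linepath p y \<theta>) = \<delta>"
      using \<delta>(1) pos by (simp add: dist_norm norm_minus_commute[of p] \<theta>_def)
    then have "linepath p y \<theta> \<in> K"
      using F_powr_linepath(1)[OF p_in_E y, of \<theta>] \<theta> unfolding K_def by simp
    then have "F (linepath p y \<theta>) powr \<beta> \<le> 1 - \<eta>" by (rule \<eta>(2))
    moreover have "1 - \<theta> < F (linepath p y \<theta>) powr \<beta>"
    proof -
      have "0 < \<theta> * F y powr \<beta>" using \<theta> F_pos[of y] y by simp
      then show ?thesis
        using F_powr_linepath(2)[OF p_in_E y, of \<theta>] \<theta> F_eq_1[OF p] by simp
    qed
    ultimately have "\<eta> \<le> \<theta>" by simp
    then have "norm (y - p) \<le> \<delta> / \<eta>"
      using pos \<eta>(1) by (simp add: \<theta>_def field_simps)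
    then show ?thesis by simp
  qed auto
  then have "E \<subseteq> cball p (max \<delta> (\<delta> / \<eta>))" by (auto simp: dist_norm norm_minus_commute)
  then show ?thesis using bounded_cball bounded_subset by blast
qed

section \<open>Consequences of Euclidean completeness\<close>

lemma euclidean_norm_le_dist:
  assumes "x \<in> H" "y \<in> H" shows "norm (y - x) \<le> euclidean.d x y"
proof (cases "x = y")
  case False
  define e where "e = (1 / norm (y - x)) *\<^sub>R (y - x)"
  have e: "norm e = 1" using False by (simp add: e_def)
  have "\<bar>e \<bullet> y - e \<bullet> x\<bar> \<le> 1 * euclidean.d x y"
  proof (rule euclidean.increment_le_dist[OF assms])
    show "((\<bullet>) e has_derivative (\<bullet>) e) (at z)" for z by (intro derivative_intros)
    show "\<bar>e \<bullet> v\<bar> \<le> 1 * sqrt (v \<bullet> v)" for v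
      using Cauchy_Schwarz_ineq2[of e v] e by (simp add: norm_eq_sqrt_inner)
  qed simp
  moreover have "e \<bullet> y - e \<bullet> x = e \<bullet> (y - x)" by (simp add: inner_diff_right)
  moreover have "e \<bullet> (y - x) = (norm (y - x))\<^sup>2 / norm (y - x)"
    by (simp add: e_def power2_norm_eq_inner)
  ultimately show ?thesis using False by (simp add: power2_eq_square)
qed (simp add: euclidean.dist_nonneg)

text \<open>Where \<open>F\<close> decreases along the segment and is bounded below, the speed of the
  projection is bounded by a constant plus a multiple of minus the derivative of \<open>F\<close>; the
  latter integrates to the total decrease.\<close>

lemma euclidean_dist_projected_segment:
  assumes ab: "a \<in> E" "b \<in> E" and c: "c > 0" "\<And>t. t \<in> {0..1} \<Longrightarrow> c \<le> F (linepath a b t)"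
    and M: "norm a \<le> M" "norm b \<le> M"
    and dec: "\<And>t. t \<in> {0..1} \<Longrightarrow> D F (linepath a b t) (b - a) \<le> 0"
  shows "euclidean.d (proj a) (proj b) \<le> norm (b - a) / c + M / c\<^sup>2 * (F a - F b)"
proof -
  let ?z = "linepath a b"
  have U: "a \<in> U" "b \<in> U" using ab by auto
  obtain L where L: "L \<in> curve_lengths H (\<lambda>x u w. u \<bullet> w) (proj a) (proj b)"
    "((\<lambda>t. sqrt (euclidean.D_proj (?z t) (b - a) \<bullet> euclidean.D_proj (?z t) (b - a))) has_integral L) {0..1}"
    using euclidean.projected_segment[OF U] by blast
  have z: "?z t \<in> U" if "t \<in> {0..1}" for t using euclidean.linepath_in_U[OF U that] .
  have nz: "norm (?z t) \<le> M" if "t \<in> {0..1}" for t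
  proof -
    have "?z t \<in> cball 0 M" using convexD_alt[OF convex_cball, of a 0 M b t] M that
      by (auto simp: linepath_def)
    then show ?thesis by simp
  qed
  have Mnn: "M \<ge> 0" using M(1) norm_ge_zero[of a] by linarith
  have "((\<lambda>t. D F (?z t) (b - a)) has_integral F (?z 1) - F (?z 0)) {0..1}"
  proof (rule fundamental_theorem_of_calculus)
    fix t :: real assume t: "t \<in> {0..1}"
    have "(?z has_vector_derivative (b - a)) (at t within {0..1})"
      by (rule has_vector_derivative_linepath_within)
    from vector_derivative_diff_chain_within[OF this has_derivative_at_withinI[OF F_has_derivative[OF z[OF t]]]]
    show "((\<lambda>t. F (?z t)) has_vector_derivative D F (?z t) (b - a)) (at t within {0..1})"
      by (simp add: o_def)
  qed simp
  then have int: "((\<lambda>t. D F (?z t) (b - a)) has_integral F b - F a) {0..1}"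
    by (simp add: linepath_def)
  have "((\<lambda>t. norm (b - a) / c + (- (M / c\<^sup>2)) * D F (?z t) (b - a)) has_integral
      norm (b - a) / c + (- (M / c\<^sup>2)) * (F b - F a)) {0..1}"
    using has_integral_add[OF has_integral_const_real[of "norm (b - a) / c" 0 1] has_integral_mult_right[OF int, of "- (M / c\<^sup>2)"]]
    by simp
  then have "L \<le> norm (b - a) / c + (- (M / c\<^sup>2)) * (F b - F a)"
  proof (rule has_integral_le[OF L(2)])
    fix t :: real assume t: "t \<in> {0..1}"
    have F: "c \<le> F (?z t)" "F (?z t) > 0" using c t by force+
    have D: "\<bar>D F (?z t) (b - a)\<bar> = - D F (?z t) (b - a)" using dec[OF t] by simp
    have "norm (euclidean.D_proj (?z t) (b - a))
        \<le> norm ((1 / F (?z t)) *\<^sub>R (b - a)) + norm ((D F (?z t) (b - a) / (F (?z t))\<^sup>2) *\<^sub>R ?z t)"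
      unfolding euclidean.D_proj_def by (rule norm_triangle_ineq4)
    also have "\<dots> = norm (b - a) / F (?z t) + (- D F (?z t) (b - a)) * norm (?z t) / (F (?z t))\<^sup>2"
      using F by (simp add: D abs_divide)
    also have "\<dots> \<le> norm (b - a) / c + (- D F (?z t) (b - a)) * M / c\<^sup>2"
    proof (intro add_mono frac_le mult_left_mono nz t power_mono)
      show "0 \<le> - D F (?z t) (b - a) * M" using dec[OF t] Mnn by (simp add: mult_nonpos_nonneg)
    qed (use F c dec[OF t] in auto)
    finally show "sqrt (euclidean.D_proj (?z t) (b - a) \<bullet> euclidean.D_proj (?z t) (b - a))
        \<le> norm (b - a) / c + (- (M / c\<^sup>2)) * D F (?z t) (b - a)"
      by (simp add: norm_eq_sqrt_inner mult.commute)
  qed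
  also have "- (M / c\<^sup>2) * (F b - F a) = M / c\<^sup>2 * (F a - F b)"
    by (metis minus_diff_eq minus_mult_minus)
  finally show ?thesis using euclidean.dist_le_length[OF L(1)] by linarith
qed

text \<open>A concave function decreases on rays issuing from its maximum point; here this follows from the
  tangent bound at the point of the ray, evaluated at \<open>p\<close>.\<close>

lemma F_decreasing_along_rays:
  assumes y: "l y = 1" and z: "linepath p y t \<in> U" "0 \<le> t"
  shows "D F (linepath p y t) (y - p) \<le> 0"
proof (cases "t = 0")
  case True
  then show ?thesis using y l_p by (simp add: linepath_def l_simps)
next
  case False
  let ?z = "linepath p y t"
  have "l ?z = 1" using y l_p by (simp add: linepath_def l_simps)
  then have zE: "?z \<in> E" using z by simp
  have "1 \<le> F ?z powr \<beta> + \<beta> * F ?z powr (\<beta> - 1) * D F ?z (p - ?z)"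
    using E_tangent_bound[OF zE p_in_E] F_eq_1[OF p] by simp
  moreover have "p - ?z = (- t) *\<^sub>R (y - p)" by (simp add: linepath_def algebra_simps)
  then have "D F ?z (p - ?z) = - t * D F ?z (y - p)"
    by (simp only: linear_cmul[OF linear_D_F[OF z(1)]] real_scaleR_def)
  ultimately have "(\<beta> * F ?z powr (\<beta> - 1) * t) * D F ?z (y - p) \<le> 0"
    using F_powr_le_1[OF zE] by (simp add: ac_simps)
  moreover have "\<beta> * F ?z powr (\<beta> - 1) * t > 0"
    using \<beta> F_pos[OF z(1)] z(2) False by simp
  ultimately show ?thesis by (meson mult_pos_pos not_le)
qed

text \<open>The radial projections of the points \<open>\<zeta> t\<close> of the segment from
  \<open>p\<close> to \<open>y\<close> have distance at most \<open>\<psi> t - \<psi> s\<close> for a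
  bounded increasing \<open>\<psi>\<close>, because \<open>F\<close> is monotone on the segment and stays
  above \<open>c\<close>. So they form a Cauchy sequence as \<open>t\<close> tends to \<open>1\<close>, and
  rescaling its limit in \<open>H\<close> to the hyperplane \<open>l = 1\<close> gives
  \<open>y\<close>.\<close>

lemma limit_of_section_in_cone:
  assumes complete: "riemannian_complete H (\<lambda>x u w. u \<bullet> w)"
    and Y: "\<And>n. Y n \<in> E" "\<And>n. c \<le> F (Y n)" "c > 0" "Y \<longlonglongrightarrow> y"
  shows "y \<in> U"
proof -
  have bl: "bounded_linear l" using linear_l linear_conv_bounded_linear by blast
  have ly: "l y = 1"
  proof -
    have "(\<lambda>n. l (Y n)) \<longlonglongrightarrow> l y" using bounded_linear.tendsto[OF bl Y(4)] .
    moreover have "(\<lambda>n. l (Y n)) = (\<lambda>n. 1)" using Y(1) by auto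
    ultimately show ?thesis using LIMSEQ_unique tendsto_const by metis
  qed
  have c1: "c \<le> 1" using Y(1,2)[of 0] F_le_1[of "Y 0"] by linarith
  define \<zeta> where "\<zeta> = linepath p y"
  have \<zeta>U: "\<zeta> t \<in> U" if "0 \<le> t" "t < 1" for t
  proof (cases "t = 0 \<or> p = y")
    case True
    then show ?thesis using H_subset_U[OF p] by (auto simp: \<zeta>_def linepath_def algebra_simps simp flip: scaleR_add_left)
  next
    case False
    have "y \<in> closure U" using Y(1,4) closure_sequential by blast
    then have "open_segment p y \<subseteq> U"
      using in_interior_closure_convex_segment[OF convex_U, of p y] H_subset_U[OF p] open_U
      by (simp add: interior_open)
    moreover have "\<zeta> t \<in> open_segment p y"
      using False that by (auto simp: in_segment \<zeta>_def linepath_def intro!: exI[of _ t])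
    ultimately show ?thesis by blast
  qed
  have \<zeta>E: "\<zeta> t \<in> E" if "0 \<le> t" "t < 1" for t
    using \<zeta>U[OF that] ly l_p by (simp add: \<zeta>_def linepath_def l_simps)
  have Fc: "c \<le> F (\<zeta> t)" if t: "0 \<le> t" "t < 1" for t
  proof -
    have "(\<lambda>n. linepath p (Y n) t) \<longlonglongrightarrow> \<zeta> t"
      unfolding \<zeta>_def linepath_def by (intro tendsto_intros Y)
    then have lim: "(\<lambda>n. F (linepath p (Y n) t)) \<longlonglongrightarrow> F (\<zeta> t)"
      by (rule euclidean.tendsto_F[OF \<zeta>U[OF t]])
    have "c \<le> F (linepath p (Y n) t)" for n
    proof -
      have E: "linepath p (Y n) t \<in> E" 
        and "(1 - t) * 1 + t * F (Y n) powr \<beta> \<le> F (linepath p (Y n) t) powr \<beta>"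
        using F_powr_linepath[OF p_in_E Y(1), of t n] t F_eq_1[OF p] by auto
      moreover have cb: "c powr \<beta> \<le> F (Y n) powr \<beta>" "c powr \<beta> \<le> 1"
        using powr_mono2[of \<beta> c "F (Y n)"] powr_mono2[of \<beta> c 1] Y(2,3) c1 \<beta> by auto
      moreover have "c powr \<beta> = (1 - t) * c powr \<beta> + t * c powr \<beta>" by (simp add: algebra_simps)
      moreover have "\<dots> \<le> (1 - t) * 1 + t * F (Y n) powr \<beta>"
        by (intro add_mono mult_left_mono cb) (use t in auto)
      ultimately have "c powr \<beta> \<le> F (linepath p (Y n) t) powr \<beta>" by linarith
      then show ?thesis
        using powr_less_mono2[of \<beta> "F (linepath p (Y n) t)" c] F_pos[of "linepath p (Y n) t"] E \<beta> by force
    qed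
    then show ?thesis by (intro tendsto_lowerbound[OF lim]) auto
  qed
  have DF: "D F (\<zeta> t) (y - p) \<le> 0" if "0 \<le> t" "t < 1" for t
    using F_decreasing_along_rays[OF ly, of t] \<zeta>U[OF that] that by (simp add: \<zeta>_def)
  obtain M where M: "\<And>z. z \<in> E \<Longrightarrow> norm z \<le> M" using bounded_E unfolding bounded_iff by blast
  have M0: "M \<ge> 0" using M[OF p_in_E] norm_ge_zero[of p] by linarith
  define \<psi> where "\<psi> = (\<lambda>t. norm (y - p) / c * t - M / c\<^sup>2 * F (\<zeta> t))"
  have step: "euclidean.d (proj (\<zeta> s)) (proj (\<zeta> t)) \<le> \<psi> t - \<psi> s" if st: "0 \<le> s" "s \<le> t" "t < 1" for s t
  proof -
    have lp: "linepath (\<zeta> s) (\<zeta> t) r = \<zeta> (linepath s t r)" for r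
      by (simp add: \<zeta>_def linepath_def algebra_simps)
    have r: "0 \<le> linepath s t r" "linepath s t r < 1" if "r \<in> {0..1}" for r
    proof -
      have "linepath s t r \<in> {s..t}"
        using linepath_in_path[OF that, of s t] st by (simp add: closed_segment_eq_real_ivl)
      then show "0 \<le> linepath s t r" "linepath s t r < 1" using st by auto
    qed
    have diff: "\<zeta> t - \<zeta> s = (t - s) *\<^sub>R (y - p)"
      by (simp add: \<zeta>_def linepath_def algebra_simps)
    have "euclidean.d (proj (\<zeta> s)) (proj (\<zeta> t)) \<le> norm (\<zeta> t - \<zeta> s) / c + M / c\<^sup>2 * (F (\<zeta> s) - F (\<zeta> t))"
    proof (rule euclidean_dist_projected_segment)
      fix r :: real assume "r \<in> {0..1}"
      note r = r[OF this]
      show "c \<le> F (linepath (\<zeta> s) (\<zeta> t) r)" unfolding lp by (rule Fc[OF r])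
      show "D F (linepath (\<zeta> s) (\<zeta> t) r) (\<zeta> t - \<zeta> s) \<le> 0"
        unfolding lp diff linear_cmul[OF linear_D_F[OF \<zeta>U[OF r]]]
        using DF[OF r] st by (simp add: mult_nonneg_nonpos)
    qed (use \<zeta>E M Y(3) st in auto)
    also have "norm (\<zeta> t - \<zeta> s) = (t - s) * norm (y - p)" using st by (simp add: diff)
    also have "(t - s) * norm (y - p) / c + M / c\<^sup>2 * (F (\<zeta> s) - F (\<zeta> t)) = \<psi> t - \<psi> s"
      by (simp add: \<psi>_def algebra_simps diff_divide_distrib)
    finally show ?thesis .
  qed
  define \<tau> where "\<tau> = (\<lambda>n::nat. real n / real (Suc n))"
  have \<tau>: "0 \<le> \<tau> n" "\<tau> n < 1" for n by (auto simp: \<tau>_def)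
  have \<tau>mono: "\<tau> m \<le> \<tau> n" if "m \<le> n" for m n
    using that by (simp add: \<tau>_def frac_le_eq divide_simps) (simp add: algebra_simps)
  have \<tau>lim: "\<tau> \<longlonglongrightarrow> 1" unfolding \<tau>_def by (rule LIMSEQ_n_over_Suc_n)
  define \<sigma> where "\<sigma> = (\<lambda>n. proj (\<zeta> (\<tau> n)))"
  have \<sigma>H: "\<sigma> n \<in> H" for n unfolding \<sigma>_def by (intro proj_in_H \<zeta>U \<tau>)
  have d: "euclidean.d (\<sigma> m) (\<sigma> n) \<le> \<psi> (\<tau> n) - \<psi> (\<tau> m)" if "m \<le> n" for m n
    unfolding \<sigma>_def using step[OF \<tau>(1) \<tau>mono[OF that] \<tau>(2)] .
  have "incseq (\<lambda>n. \<psi> (\<tau> n))"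
    unfolding incseq_def using d euclidean.dist_nonneg by (meson diff_ge_0_iff_ge order_trans)
  moreover have "\<psi> (\<tau> n) \<le> norm (y - p) / c" for n
  proof -
    have "norm (y - p) / c * \<tau> n \<le> norm (y - p) / c * 1"
      using \<tau>[of n] Y(3) by (intro mult_left_mono) auto
    moreover have "M / c\<^sup>2 * F (\<zeta> (\<tau> n)) \<ge> 0" using M0 F_pos[OF \<zeta>U[OF \<tau>], of n] by simp
    ultimately show ?thesis by (simp add: \<psi>_def)
  qed
  ultimately have "convergent (\<lambda>n. \<psi> (\<tau> n))"
    by (metis incseq_convergent convergentI)
  then have cau: "Cauchy (\<lambda>n. \<psi> (\<tau> n))" by (rule convergent_Cauchy)
  interpret M: Metric_space H euclidean.d by (rule euclidean.metric_space)
  have "M.MCauchy \<sigma>"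
    unfolding M.MCauchy_def
  proof (intro conjI allI impI)
    show "range \<sigma> \<subseteq> H" using \<sigma>H by blast
    fix \<epsilon> :: real assume "\<epsilon> > 0"
    then obtain N where N: "\<And>m n. m \<ge> N \<Longrightarrow> n \<ge> N \<Longrightarrow> dist (\<psi> (\<tau> m)) (\<psi> (\<tau> n)) < \<epsilon>"
      using cau unfolding Cauchy_def by blast
    have "euclidean.d (\<sigma> n) (\<sigma> n') < \<epsilon>" if "N \<le> n" "N \<le> n'" for n n'
      using d[of n n'] d[of n' n] N[OF that] euclidean.dist_symmetric[of "\<sigma> n" "\<sigma> n'"]
      by (cases "n \<le> n'") (auto simp: dist_real_def)
    then show "\<exists>N. \<forall>n n'. N \<le> n \<longrightarrow> N \<le> n' \<longrightarrow> euclidean.d (\<sigma> n) (\<sigma> n') < \<epsilon>" by blast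
  qed
  then obtain z where "limitin M.mtopology \<sigma> z sequentially"
    using complete unfolding riemannian_complete_def M.mcomplete_def by blast
  then have z: "z \<in> H" "\<And>\<epsilon>. \<epsilon> > 0 \<Longrightarrow> \<exists>N. \<forall>n\<ge>N. euclidean.d (\<sigma> n) z < \<epsilon>"
    unfolding M.limit_metric_sequentially by blast+
  have \<sigma>z: "\<sigma> \<longlonglongrightarrow> z"
    unfolding lim_sequentially
  proof (intro allI impI)
    fix \<epsilon> :: real assume "\<epsilon> > 0"
    then obtain N where "\<forall>n\<ge>N. euclidean.d (\<sigma> n) z < \<epsilon>" using z(2) by blast
    then show "\<exists>N. \<forall>n\<ge>N. dist (\<sigma> n) z < \<epsilon>"
      using euclidean_norm_le_dist[OF \<sigma>H z(1)] by (metis dist_commute dist_norm order_le_less_trans)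
  qed
  have eq: "(1 / l (\<sigma> n)) *\<^sub>R \<sigma> n = \<zeta> (\<tau> n)" for n
    using F_pos[OF \<zeta>U[OF \<tau>], of n] \<zeta>E[OF \<tau>, of n] by (simp add: \<sigma>_def proj_def l_simps)
  have lz: "l z > 0" using l_pos[OF H_subset_U[OF z(1)]] .
  have "(\<lambda>n. (1 / l (\<sigma> n)) *\<^sub>R \<sigma> n) \<longlonglongrightarrow> (1 / l z) *\<^sub>R z"
    by (intro tendsto_intros \<sigma>z bounded_linear.tendsto[OF bl]) (use lz in auto)
  moreover have "(\<lambda>n. \<zeta> (\<tau> n)) \<longlonglongrightarrow> \<zeta> 1"
    unfolding \<zeta>_def linepath_def by (intro tendsto_intros \<tau>lim)
  ultimately have "\<zeta> 1 = (1 / l z) *\<^sub>R z"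
    unfolding eq using LIMSEQ_unique by blast
  then have "y = (1 / l z) *\<^sub>R z" by (simp add: \<zeta>_def linepath_def)
  then show ?thesis using U_scale(1)[OF H_subset_U[OF z(1)], of "1 / l z"] lz by simp
qed

text \<open>For closedness, rescale a convergent sequence in the set to the section. There \<open>F\<close>
  is at least \<open>1 / R\<close>, so the rescaled limit lies in the cone, and continuity of
  \<open>F\<close> puts the original limit on \<open>H\<close>.\<close>

lemma compact_sublevel:
  assumes "riemannian_complete H (\<lambda>x u w. u \<bullet> w)"
  shows "compact {x \<in> H. l x \<le> R}"
  unfolding compact_eq_bounded_closed
proof
  have bl: "bounded_linear l" using linear_l linear_conv_bounded_linear by blast
  obtain M where M: "\<And>z. z \<in> E \<Longrightarrow> norm z \<le> M" using bounded_E unfolding bounded_iff by blast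
  have "norm x \<le> R * M" if "x \<in> H" "l x \<le> R" for x
  proof -
    have l: "l x \<ge> 1" "(1 / l x) *\<^sub>R x \<in> E"
      using l_ge_1[OF that(1)] scale_in_E[OF H_subset_U[OF that(1)]] by auto
    then have "norm x / l x \<le> M" using M[OF l(2)] by simp
    then have "norm x \<le> M * l x" using l(1) by (simp add: field_simps)
    also have "\<dots> \<le> M * R"
      using that(2) M[OF p_in_E] norm_ge_zero[of p] by (intro mult_left_mono) linarith+
    finally show ?thesis by (simp add: mult.commute)
  qed
  then show "bounded {x \<in> H. l x \<le> R}" unfolding bounded_iff by blast
  show "closed {x \<in> H. l x \<le> R}"
    unfolding closed_sequential_limits
  proof (intro allI impI)
    fix X x assume "(\<forall>n. X n \<in> {x \<in> H. l x \<le> R}) \<and> X \<longlonglongrightarrow> x"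
    then have X: "\<And>n. X n \<in> H" "\<And>n. l (X n) \<le> R" "X \<longlonglongrightarrow> x" by auto
    have lX: "(\<lambda>n. l (X n)) \<longlonglongrightarrow> l x" using bounded_linear.tendsto[OF bl X(3)] .
    have lx: "1 \<le> l x" by (rule tendsto_lowerbound[OF lX]) (auto simp: l_ge_1 X)
    have R: "l x \<le> R" by (rule tendsto_upperbound[OF lX]) (auto simp: X)
    have "(1 / l x) *\<^sub>R x \<in> U"
    proof (rule limit_of_section_in_cone[OF assms, where c = "1 / R"])
      fix n
      have l: "l (X n) \<ge> 1" using l_ge_1 X by blast
      then show "(1 / l (X n)) *\<^sub>R X n \<in> E" using scale_in_E[OF H_subset_U[OF X(1)], of n] by simp
      show "1 / R \<le> F ((1 / l (X n)) *\<^sub>R X n)"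
        using U_scale(2)[OF H_subset_U[OF X(1)], of "1 / l (X n)" n] l X(2)[of n] F_eq_1[OF X(1)]
        by (simp add: frac_le)
    next
      show "1 / R > 0" using R lx by simp
      show "(\<lambda>n. (1 / l (X n)) *\<^sub>R X n) \<longlonglongrightarrow> (1 / l x) *\<^sub>R x"
        by (intro tendsto_intros X lX) (use lx in auto)
    qed
    from U_scale(1)[OF this, of "l x"] have xU: "x \<in> U" using lx by simp
    have "(\<lambda>n. F (X n)) \<longlonglongrightarrow> F x" using euclidean.tendsto_F[OF xU X(3)] .
    then have "F x = 1" using F_eq_1 X(1) LIMSEQ_unique[OF _ tendsto_const] by simp
    then have "x \<in> H" using F_eq_1_iff xU by blast
    then show "x \<in> {x \<in> H. l x \<le> R}" using R by simp
  qed
qed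

section \<open>Completeness of the centroaffine metric\<close>

text \<open>By \<open>metric_lower_bound\<close> the function \<open>ln \<circ> l\<close> is Lipschitz,
  hence bounded on a Cauchy sequence.\<close>

lemma centroaffine_complete:
  assumes "riemannian_complete H (\<lambda>x u w. u \<bullet> w)"
  shows "riemannian_complete H (centroaffine_metric H)"
proof (rule centroaffine.complete_if_Cauchy_in_compact)
  interpret M: Metric_space H centroaffine.d by (rule centroaffine.metric_space)
  fix \<sigma> assume \<sigma>: "M.MCauchy \<sigma>"
  have \<sigma>H: "\<sigma> n \<in> H" for n using \<sigma> unfolding M.MCauchy_def by blast
  define C where "C = 1 / sqrt (\<beta> - 1)"
  have C: "C > 0" using \<beta> by (simp add: C_def)
  have lip: "\<bar>ln (l y) - ln (l x)\<bar> \<le> C * centroaffine.d x y" if "x \<in> H" "y \<in> H" for x y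
  proof (rule centroaffine.increment_le_dist[OF that C])
    fix z assume z: "z \<in> H"
    have lz: "l z > 0" using l_pos H_subset_U z by blast
    have "(l has_derivative l) (at z)"
      using linear_l linear_conv_bounded_linear bounded_linear_imp_has_derivative by blast
    then show "((\<lambda>z. ln (l z)) has_derivative (\<lambda>v. l v / l z)) (at z)"
      using has_derivative_ln[where g = l and x = z, OF lz] by (simp add: divide_inverse)
    fix v assume v: "v \<in> tangent_space H z"
    have "sqrt ((\<beta> - 1) * (l v / l z)\<^sup>2) \<le> sqrt (centroaffine_metric H z v v)"
      using metric_lower_bound[OF z v] by simp
    then have "sqrt (\<beta> - 1) * \<bar>l v / l z\<bar> \<le> sqrt (centroaffine_metric H z v v)"
      by (simp add: real_sqrt_mult)
    then show "\<bar>l v / l z\<bar> \<le> C * sqrt (centroaffine_metric H z v v)"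
      using \<beta> by (simp add: C_def field_simps)
  qed
  obtain N where N: "\<And>n. n \<ge> N \<Longrightarrow> centroaffine.d (\<sigma> N) (\<sigma> n) < 1"
    using \<sigma> unfolding M.MCauchy_def by (meson order_refl zero_less_one)
  define R where "R = max (Max ((\<lambda>n. l (\<sigma> n)) ` {..N})) (l (\<sigma> N) * exp C)"
  have "l (\<sigma> n) \<le> R" for n
  proof (cases "n \<le> N")
    case True
    then have "l (\<sigma> n) \<le> Max ((\<lambda>n. l (\<sigma> n)) ` {..N})" by (intro Max_ge) auto
    then show ?thesis by (simp add: R_def)
  next
    case False
    have pos: "l (\<sigma> n) > 0" "l (\<sigma> N) > 0" using l_pos H_subset_U \<sigma>H by blast+
    have "C * centroaffine.d (\<sigma> N) (\<sigma> n) \<le> C * 1"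
      using N[of n] False C by (intro mult_left_mono) auto
    then have "ln (l (\<sigma> n)) \<le> ln (l (\<sigma> N)) + C"
      using lip[OF \<sigma>H \<sigma>H, of n N] by linarith
    then have "exp (ln (l (\<sigma> n))) \<le> exp (ln (l (\<sigma> N)) + C)" by simp
    then show ?thesis using pos by (simp add: R_def exp_add)
  qed
  then show "\<exists>K. compact K \<and> K \<subseteq> H \<and> range \<sigma> \<subseteq> K"
    using compact_sublevel[OF assms, of R] \<sigma>H by (intro exI[of _ "{x \<in> H. l x \<le> R}"]) auto
qed

end

theorem lemma1p15:
  fixes n :: nat and H :: "'a::euclidean_space set" and k :: real
    and h :: "'a \<Rightarrow> real" and p :: 'a
  assumes "n \<ge> 1" and "DIM('a) = n + 1"
    and "hyperbolic_centroaffine H" and "connected H" and "euclidean_complete H"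
    and "k > 0" and "corresponding_homogeneous H k h"
    and "p \<in> H"
    and "\<exists>\<epsilon>. 0 < \<epsilon> \<and> \<epsilon> < k \<and>
           concave_on (positive_cone H \<inter> affine_tangent_hyperplane H p)
             (\<lambda>y. h y powr (1 / (k - \<epsilon>)))"
  shows "riemannian_complete H (centroaffine_metric H)"
proof -
  obtain \<epsilon> where \<epsilon>: "0 < \<epsilon>" "\<epsilon> < k"
    and conc: "concave_on (positive_cone H \<inter> affine_tangent_hyperplane H p) (\<lambda>y. h y powr (1 / (k - \<epsilon>)))"
    using assms(9) by blast
  define F where "F = (\<lambda>y. h y powr (1 / k))"
  define \<beta> where "\<beta> = k / (k - \<epsilon>)"
  interpret radial_hypersurface H F
  proof
    show "centroaffine_hypersurface H"
      using assms(3) unfolding hyperbolic_centroaffine_def by blast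
    show "F (r *\<^sub>R x) = r" if "r > 0" "x \<in> H" for r x
    proof -
      have "h (r *\<^sub>R x) = r powr k"
        using assms(7) that unfolding corresponding_homogeneous_def by blast
      then show ?thesis using that assms(6) by (simp add: F_def powr_powr)
    qed
  qed
  have lp: "D F p p = 1" using Euler_identity[OF H_subset_U] F_eq_1 assms(8) by simp
  have "affine_tangent_hyperplane H p = {y. D F p y = 1}"
  proof (intro equalityI subsetI CollectI)
    fix y assume "y \<in> affine_tangent_hyperplane H p"
    then show "D F p y = 1"
      unfolding affine_tangent_hyperplane_def
      using lp tangent_space_eq_kernel[OF assms(8)] linear_add[OF linear_D_F[OF H_subset_U[OF assms(8)]]] by auto
  next
    fix y assume "y \<in> {y. D F p y = 1}"
    then have "y - p \<in> tangent_space H p"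
      using lp tangent_space_eq_kernel[OF assms(8)] linear_diff[OF linear_D_F[OF H_subset_U[OF assms(8)]]] by auto
    then show "y \<in> affine_tangent_hyperplane H p"
      unfolding affine_tangent_hyperplane_def by (intro CollectI exI[of _ "y - p"]) auto
  qed
  moreover have "h y powr (1 / (k - \<epsilon>)) = F y powr \<beta>" for y
    using assms(6) \<epsilon> by (simp add: F_def \<beta>_def powr_powr)
  ultimately have conc': "concave_on (U \<inter> {y. D F p y = 1}) (\<lambda>y. F y powr \<beta>)"
    using conc by simp
  interpret concave_section H F p \<beta>
  proof
    show "\<beta> > 1" using \<epsilon> by (simp add: \<beta>_def field_simps)
    show "centroaffine_metric H x v v > 0" if "x \<in> H" "v \<in> tangent_space H x" "v \<noteq> 0" for x v
      using assms(3) that unfolding hyperbolic_centroaffine_def by blast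
  qed (use assms conc' in auto)
  show ?thesis
    using centroaffine_complete assms(5) unfolding euclidean_complete_def by blast
qed

end
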